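(* Let $\mathcal R$ be a p.m.p. ergodic equivalence relation on a standard probability space $(X,\mu)$, and let $\mathcal S\in\mathrm{Sub}(\mathcal R)$ be aperiodic and have everywhere infinite index in $\mathcal R$. Then the closure of the $[\mathcal R]$-orbit of $\mathcal S$ in $\mathrm{Sub}(\mathcal R)$ contains $\mathrm{Sub}_{\mathrm{hyp}}(\mathcal R)$.
   Context: Standard probability spaces are atomless. A p.m.p. equivalence relation $\mathcal R$ on $(X,\mu)$ is the orbit equivalence relation of a measure-preserving Borel action of a countable group on $(X,\mu)$. It is ergodic if every $\mathcal R$-invariant Borel set is null or conull, aperiodic if almost all its classes are infinite, and hyperfinite if on a conull set it is an increasing union of Borel equivalence relations with finite classes. Everything is considered up to null sets. Equip $\mathcal R$ with the measure $M(A)=\int_X|A_x|\,d\mu(x)$, where $A_x=\{y:(x,y)\in A\}$; $\mathrm{MAlg}(\mathcal R,M)$ is the space of Borel subsets of $\mathcal R$ modulo $M$-null sets with the topology of the metric $d_m(A,B)=m(A\triangle B)$, for $m$ any finite measure equivalent to $M$ (the topology does not depend on $m$). $\mathrm{Sub}(\mathcal R)\subseteq\mathrm{MAlg}(\mathcal R,M)$ is the subspace of (classes of) Borel equivalence relations on $X$ contained in $\mathcal R$, and $\mathrm{Sub}_{\mathrm{hyp}}(\mathcal R)$ is its subset of hyperfinite ones. The full group $[\mathcal R]$ consists of all measure-preserving automorphisms $T$ of $(X,\mu)$ (mod null sets) with $(x,T(x))\in\mathcal R$ for almost every $x$; it acts on $\mathrm{Sub}(\mathcal R)$ by $T\cdot\mathcal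 S=(T\times T)(\mathcal S)$. $\mathcal S$ has everywhere infinite index in $\mathcal R$ if for every Borel $A\subseteq X$ with $\mu(A)>0$, for almost every $x\in A$ the $\mathcal R_{\restriction A}$-class of $x$ contains infinitely many distinct $\mathcal S_{\restriction A}$-classes, where $\mathcal R_{\restriction A}=\mathcal R\cap(A\times A)$. *)

theory Defs
  imports "HOL-Probability.Probability" "HOL-Algebra.Group_Action"
begin

section \<open>Standard probability spaces and p.m.p. equivalence relations\<close>

definition standard_borel :: "'a measure \<Rightarrow> bool" where
  "standard_borel M \<longleftrightarrow>
     (\<exists>T. completely_metrizable_space T \<and> second_countable T \<and>
          topspace T = space M \<and> sets M = sigma_sets (space M) {U. openin T U})"

definition atomless :: "'a measure \<Rightarrow> bool" where
  "atomless M \<longleftrightarrow>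
     (\<forall>A\<in>sets M. 0 < emeasure M A \<longrightarrow>
        (\<exists>B\<in>sets M. B \<subseteq> A \<and> 0 < emeasure M B \<and> emeasure M B < emeasure M A))"

definition standard_prob_space :: "'a measure \<Rightarrow> bool" where
  "standard_prob_space M \<longleftrightarrow> prob_space M \<and> standard_borel M \<and> atomless M"

text \<open>A countable group is, up to isomorphism, a group whose carrier is a set of natural
  numbers; this avoids an existential quantifier over types.\<close>

definition pmp_equiv_rel :: "'a measure \<Rightarrow> ('a \<times> 'a) set \<Rightarrow> bool" where
  "pmp_equiv_rel M R \<longleftrightarrow>
     (\<exists>(G :: nat monoid) \<phi>. group_action G (space M) \<phi> \<and>
        (\<forall>g\<in>carrier G. \<phi> g \<in> M \<rightarrow>\<^sub>M M \<and> distr M M (\<phi> g) = M) \<and>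
        R = {(x, \<phi> g x) | x g. x \<in> space M \<and> g \<in> carrier G})"

definition ergodic_rel :: "'a measure \<Rightarrow> ('a \<times> 'a) set \<Rightarrow> bool" where
  "ergodic_rel M R \<longleftrightarrow>
     (\<forall>A\<in>sets M. R `` A \<subseteq> A \<longrightarrow> A \<in> null_sets M \<or> space M - A \<in> null_sets M)"

definition aperiodic_rel :: "'a measure \<Rightarrow> ('a \<times> 'a) set \<Rightarrow> bool" where
  "aperiodic_rel M S \<longleftrightarrow> (AE x in M. infinite (S `` {x}))"

definition hyperfinite_rel :: "'a measure \<Rightarrow> ('a \<times> 'a) set \<Rightarrow> bool" where
  "hyperfinite_rel M S \<longleftrightarrow>
     (\<exists>X0\<in>sets M. space M - X0 \<in> null_sets M \<and>
        (\<exists>F :: nat \<Rightarrow> ('a \<times> 'a) set. incseq F \<and>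
           (\<forall>n. F n \<in> sets (M \<Otimes>\<^sub>M M) \<and> equiv X0 (F n) \<and> (\<forall>x\<in>X0. finite (F n `` {x}))) \<and>
           S \<inter> (X0 \<times> X0) = (\<Union>n. F n)))"

definition everywhere_infinite_index ::
  "'a measure \<Rightarrow> ('a \<times> 'a) set \<Rightarrow> ('a \<times> 'a) set \<Rightarrow> bool" where
  "everywhere_infinite_index M R S \<longleftrightarrow>
     (\<forall>A\<in>sets M. 0 < emeasure M A \<longrightarrow>
        (AE x in M. x \<in> A \<longrightarrow> infinite (((R \<inter> A \<times> A) `` {x}) // (S \<inter> A \<times> A))))"


section \<open>Measure algebras\<close>

definition null_rel :: "'b measure \<Rightarrow> ('b set \<times> 'b set) set" where
  "null_rel N = {(A, B). A \<in> sets N \<and> B \<in> sets N \<and> emeasure N (sym_diff A B) = 0}"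

definition malg :: "'b measure \<Rightarrow> 'b set set set" where
  "malg N = sets N // null_rel N"

definition malg_class :: "'b measure \<Rightarrow> 'b set \<Rightarrow> 'b set set" where
  "malg_class N A = null_rel N `` {A}"

text \<open>The distance between two classes is computed on arbitrary representatives; see
  \<open>malg_dist_class\<close> below for the independence of the choice.\<close>

definition malg_dist :: "'b measure \<Rightarrow> 'b set set \<Rightarrow> 'b set set \<Rightarrow> real" where
  "malg_dist m P Q = measure m (sym_diff (SOME A. A \<in> P) (SOME B. B \<in> Q))"

definition equivalent_measures :: "'b measure \<Rightarrow> 'b measure \<Rightarrow> bool" where
  "equivalent_measures m N \<longleftrightarrow>
     sets m = sets N \<and> absolutely_continuous m N \<and> absolutely_continuous N m"


section \<open>The space of subrelations and the full group\<close>

definition rel_measure :: "'a measure \<Rightarrow> ('a \<times> 'a) set \<Rightarrow> ('a \<times> 'a) measure" where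
  "rel_measure M R =
     measure_of R {A \<in> sets (M \<Otimes>\<^sub>M M). A \<subseteq> R}
       (\<lambda>A. \<integral>\<^sup>+x. emeasure (count_space UNIV) (A `` {x}) \<partial>M)"

definition borel_subrels :: "'a measure \<Rightarrow> ('a \<times> 'a) set \<Rightarrow> ('a \<times> 'a) set set" where
  "borel_subrels M R = {S \<in> sets (M \<Otimes>\<^sub>M M). S \<subseteq> R \<and> equiv (space M) S}"

definition Sub :: "'a measure \<Rightarrow> ('a \<times> 'a) set \<Rightarrow> ('a \<times> 'a) set set set" where
  "Sub M R = malg_class (rel_measure M R) ` borel_subrels M R"

definition Sub_hyp :: "'a measure \<Rightarrow> ('a \<times> 'a) set \<Rightarrow> ('a \<times> 'a) set set set" where
  "Sub_hyp M R =
     malg_class (rel_measure M R) ` {S \<in> borel_subrels M R. hyperfinite_rel M S}"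

definition Sub_topology ::
  "'a measure \<Rightarrow> ('a \<times> 'a) set \<Rightarrow> ('a \<times> 'a) measure \<Rightarrow> ('a \<times> 'a) set set topology" where
  "Sub_topology M R m =
     subtopology (Metric_space.mtopology (malg (rel_measure M R)) (malg_dist m)) (Sub M R)"

text \<open>Every automorphism modulo null sets is represented by a Borel automorphism defined
  everywhere, so the elements of the full group are given by such representatives.\<close>

definition full_group :: "'a measure \<Rightarrow> ('a \<times> 'a) set \<Rightarrow> ('a \<Rightarrow> 'a) set" where
  "full_group M R =
     {T. T \<in> M \<rightarrow>\<^sub>M M \<and> bij_betw T (space M) (space M) \<and>
         the_inv_into (space M) T \<in> M \<rightarrow>\<^sub>M M \<and> distr M M T = M \<and>
         (AE x in M. (x, T x) \<in> R)}"

text \<open>As \<open>(x, T x) \<in> R\<close> is only required almost everywhere, \<open>(T \<times> T)(S)\<close> need not be a subset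
  of \<open>R\<close>.  Intersecting with \<open>R\<close> only removes pairs in a null set, and yields a genuine
  Borel subrelation of \<open>R\<close>.\<close>

definition full_group_orbit ::
  "'a measure \<Rightarrow> ('a \<times> 'a) set \<Rightarrow> ('a \<times> 'a) set \<Rightarrow> ('a \<times> 'a) set set set" where
  "full_group_orbit M R S =
     {malg_class (rel_measure M R) (map_prod T T ` S \<inter> R) | T. T \<in> full_group M R}"


section \<open>Well-definedness\<close>

lemma equiv_null_rel: "equiv (sets N) (null_rel N)"
proof (rule equivI)
  show "null_rel N \<subseteq> sets N \<times> sets N" by (auto simp: null_rel_def)
  show "refl_on (sets N) (null_rel N)" by (auto simp: null_rel_def refl_on_def)
  show "sym (null_rel N)" by (auto simp: null_rel_def sym_def Un_commute)
  show "trans (null_rel N)"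
  proof (rule transI)
    fix A B C assume "(A, B) \<in> null_rel N" "(B, C) \<in> null_rel N"
    then have m: "A \<in> sets N" "B \<in> sets N" "C \<in> sets N"
      and z: "sym_diff A B \<in> null_sets N" "sym_diff B C \<in> null_sets N"
      by (auto simp: null_rel_def null_sets_def)
    have "sym_diff A B \<union> sym_diff B C \<in> null_sets N" using z by (rule null_sets.Un)
    then have "sym_diff A C \<in> null_sets N"
      by (rule null_sets_subset) (use m in auto)
    then show "(A, C) \<in> null_rel N" using m by (auto simp: null_rel_def null_sets_def)
  qed
qed

lemma malg_class_in_malg: "A \<in> sets N \<Longrightarrow> malg_class N A \<in> malg N"
  by (auto simp: malg_def malg_class_def quotient_def)

lemma malg_cases:
  assumes "P \<in> malg N" obtains A where "A \<in> sets N" "P = malg_class N A"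
  using assms by (auto simp: malg_def malg_class_def quotient_def)

lemma malg_class_eq_iff:
  assumes "A \<in> sets N" "B \<in> sets N"
  shows "malg_class N A = malg_class N B \<longleftrightarrow> emeasure N (sym_diff A B) = 0"
  using eq_equiv_class_iff[OF equiv_null_rel assms] assms
  by (auto simp: malg_class_def null_rel_def)

lemma equivalent_measures_null_iff:
  assumes "equivalent_measures m N" "A \<in> sets N"
  shows "emeasure m A = 0 \<longleftrightarrow> emeasure N A = 0"
  using assms by (auto simp: equivalent_measures_def absolutely_continuous_def null_sets_def)

lemma malg_dist_class:
  assumes fin: "finite_measure m" and eq: "equivalent_measures m N"
    and A: "A \<in> sets N" and B: "B \<in> sets N"
  shows "malg_dist m (malg_class N A) (malg_class N B) = measure m (sym_diff A B)"
proof -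
  interpret finite_measure m by (rule fin)
  have sm: "sets m = sets N" using eq by (simp add: equivalent_measures_def)
  have some: "(SOME C. C \<in> malg_class N D) \<in> malg_class N D" if "D \<in> sets N" for D
    by (rule someI[of _ D]) (use that in \<open>auto simp: malg_class_def null_rel_def\<close>)
  define A' where "A' = (SOME C. C \<in> malg_class N A)"
  define B' where "B' = (SOME C. C \<in> malg_class N B)"
  have A': "A' \<in> sets N" "emeasure N (sym_diff A A') = 0"
    using some[OF A] by (auto simp: A'_def malg_class_def null_rel_def)
  have B': "B' \<in> sets N" "emeasure N (sym_diff B B') = 0"
    using some[OF B] by (auto simp: B'_def malg_class_def null_rel_def)
  have nA: "sym_diff A A' \<in> null_sets m" "sym_diff B B' \<in> null_sets m"
    using A' B' A B equivalent_measures_null_iff[OF eq] sm by (auto simp: null_sets_def)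
  have "AE x in m. x \<in> sym_diff A' B' \<longleftrightarrow> x \<in> sym_diff A B"
    using AE_not_in[OF nA(1)] AE_not_in[OF nA(2)] by eventually_elim auto
  then have "measure m (sym_diff A' B') = measure m (sym_diff A B)"
    by (intro measure_eq_AE) (use A B A' B' sm in auto)
  then show ?thesis by (simp add: malg_dist_def A'_def B'_def)
qed

lemma Metric_space_malg:
  assumes fin: "finite_measure m" and eq: "equivalent_measures m N"
  shows "Metric_space (malg N) (malg_dist m)"
proof
  interpret finite_measure m by (rule fin)
  have sm: "sets m = sets N" using eq by (simp add: equivalent_measures_def)
  note d = malg_dist_class[OF fin eq]
  show "0 \<le> malg_dist m P Q" for P Q by (simp add: malg_dist_def)
  show "malg_dist m P Q = malg_dist m Q P" for P Q by (simp add: malg_dist_def Un_commute)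
  show "malg_dist m P Q = 0 \<longleftrightarrow> P = Q" if "P \<in> malg N" "Q \<in> malg N" for P Q
  proof -
    obtain A B where AB: "A \<in> sets N" "B \<in> sets N" "P = malg_class N A" "Q = malg_class N B"
      using \<open>P \<in> malg N\<close> \<open>Q \<in> malg N\<close> by (metis malg_cases)
    have "measure m (sym_diff A B) = 0 \<longleftrightarrow> emeasure m (sym_diff A B) = 0"
      by (simp add: emeasure_eq_measure)
    then show ?thesis
      using AB d equivalent_measures_null_iff[OF eq, of "sym_diff A B"]
      by (auto simp: malg_class_eq_iff)
  qed
  show "malg_dist m P U \<le> malg_dist m P Q + malg_dist m Q U"
    if "P \<in> malg N" "Q \<in> malg N" "U \<in> malg N" for P Q U
  proof -
    obtain A where A: "A \<in> sets N" "P = malg_class N A"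
      using \<open>P \<in> malg N\<close> by (rule malg_cases)
    obtain B where B: "B \<in> sets N" "Q = malg_class N B"
      using \<open>Q \<in> malg N\<close> by (rule malg_cases)
    obtain C where C: "C \<in> sets N" "U = malg_class N C"
      using \<open>U \<in> malg N\<close> by (rule malg_cases)
    note AB = A B C
    have "measure m (sym_diff A C) \<le> measure m (sym_diff A B \<union> sym_diff B C)"
      by (rule finite_measure_mono) (use AB sm in auto)
    also have "\<dots> \<le> measure m (sym_diff A B) + measure m (sym_diff B C)"
      by (rule measure_Un_le) (use AB sm in auto)
    finally show ?thesis using AB d by simp
  qed
qed

lemma standard_borel_diagonal:
  assumes "standard_borel M"
  shows "{(x, x) | x. x \<in> space M} \<in> sets (M \<Otimes>\<^sub>M M)"
proof -
  obtain T where T: "completely_metrizable_space T" "second_countable T"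
    "topspace T = space M" "sets M = sigma_sets (space M) {U. openin T U}"
    using assms by (auto simp: standard_borel_def)
  have met: "metrizable_space T" using T(1) by (rule completely_metrizable_imp_metrizable_space)
  obtain B where B: "countable B" "\<And>V. V \<in> B \<Longrightarrow> openin T V"
    "\<And>U x. openin T U \<Longrightarrow> x \<in> U \<Longrightarrow> \<exists>V\<in>B. x \<in> V \<and> V \<subseteq> U"
    using T(2) unfolding second_countable_def by metis
  have Bs: "V \<in> sets M" if "V \<in> B" for V using T(4) B(2)[OF that] by auto
  have haus: "Hausdorff_space T" using met by (rule metrizable_imp_Hausdorff_space)
  define P where "P = {(U, V). U \<in> B \<and> V \<in> B \<and> U \<inter> V = {}}"
  have "countable P" by (rule countable_subset[of _ "B \<times> B"]) (use B in \<open>auto simp: P_def\<close>)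
  then have off: "(\<Union>(U, V)\<in>P. U \<times> V) \<in> sets (M \<Otimes>\<^sub>M M)"
    by (intro sets.countable_UN'') (auto simp: P_def Bs)
  have sub: "V \<subseteq> space M" if "V \<in> B" for V using sets.sets_into_space[OF Bs[OF that]] .
  have "{(x, x) | x. x \<in> space M} = space (M \<Otimes>\<^sub>M M) - (\<Union>(U, V)\<in>P. U \<times> V)"
  proof (intro equalityI subsetI)
    fix p assume "p \<in> {(x, x) | x. x \<in> space M}"
    then show "p \<in> space (M \<Otimes>\<^sub>M M) - (\<Union>(U, V)\<in>P. U \<times> V)"
      by (auto simp: P_def space_pair_measure)
  next
    fix p assume p: "p \<in> space (M \<Otimes>\<^sub>M M) - (\<Union>(U, V)\<in>P. U \<times> V)"
    obtain x y where xy: "p = (x, y)" "x \<in> space M" "y \<in> space M"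
      using p by (auto simp: space_pair_measure)
    have "x = y"
    proof (rule ccontr)
      assume "x \<noteq> y"
      then obtain U V where UV: "openin T U" "openin T V" "x \<in> U" "y \<in> V" "disjnt U V"
        using haus xy T(3) unfolding Hausdorff_space_def by metis
      obtain U' V' where "U' \<in> B" "x \<in> U'" "U' \<subseteq> U" "V' \<in> B" "y \<in> V'" "V' \<subseteq> V"
        using B(3) UV by metis
      then have "(U', V') \<in> P" "p \<in> U' \<times> V'" using UV xy by (auto simp: P_def disjnt_def)
      then show False using p by blast
    qed
    then show "p \<in> {(x, x) | x. x \<in> space M}" using xy by auto
  qed
  then show ?thesis using off by simp
qed

lemma pmp_equiv_rel_enum:
  assumes "pmp_equiv_rel M R"
  obtains g :: "nat \<Rightarrow> 'a \<Rightarrow> 'a" where "\<And>i. g i \<in> M \<rightarrow>\<^sub>M M" "\<And>i. distr M M (g i) = M"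
    "R = {(x, g i x) | x i. x \<in> space M}"
proof -
  obtain G :: "nat monoid" and \<phi> where G: "group_action G (space M) \<phi>"
    "\<And>g. g \<in> carrier G \<Longrightarrow> \<phi> g \<in> M \<rightarrow>\<^sub>M M \<and> distr M M (\<phi> g) = M"
    "R = {(x, \<phi> g x) | x g. x \<in> space M \<and> g \<in> carrier G}"
    using assms unfolding pmp_equiv_rel_def by blast
  have "group G" using G(1) by (simp add: group_action_def group_hom_def)
  then have ne: "carrier G \<noteq> {}" using monoid.one_closed[of G] group.is_monoid by blast
  have r: "range (from_nat_into (carrier G)) = carrier G"
    using ne by (intro range_from_nat_into) auto
  then have "R = {(x, \<phi> (from_nat_into (carrier G) i) x) | x i. x \<in> space M}"
    unfolding G(3) by (auto intro: from_nat_into[OF ne]) (metis from_nat_into_surj countableI_type)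
  then show thesis
    using G(2) from_nat_into[OF ne]
    by (intro that[of "\<lambda>i. \<phi> (from_nat_into (carrier G) i)"]) auto
qed

lemma graph_measurable:
  assumes "standard_borel M" "g \<in> M \<rightarrow>\<^sub>M M" "h \<in> M \<rightarrow>\<^sub>M M"
  shows "{x \<in> space M. g x = h x} \<in> sets M"
    and "{(x, g x) | x. x \<in> space M} \<in> sets (M \<Otimes>\<^sub>M M)"
proof -
  note [measurable] = assms(2,3) and D = standard_borel_diagonal[OF assms(1)]
  have gs: "g x \<in> space M" if "x \<in> space M" for x
    using measurable_space[OF assms(2) that] .
  have "(\<lambda>x. (g x, h x)) -` {(x, x) | x. x \<in> space M} \<inter> space M \<in> sets M"
    by (rule measurable_sets[OF _ D]) measurable
  also have "(\<lambda>x. (g x, h x)) -` {(x, x) | x. x \<in> space M} \<inter> space M = {x \<in> space M. g x = h x}"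
    using gs by auto
  finally show "{x \<in> space M. g x = h x} \<in> sets M" .
  have "(\<lambda>p. (g (fst p), snd p)) -` {(x, x) | x. x \<in> space M} \<inter> space (M \<Otimes>\<^sub>M M)
      \<in> sets (M \<Otimes>\<^sub>M M)"
    by (rule measurable_sets[OF _ D]) measurable
  also have "(\<lambda>p. (g (fst p), snd p)) -` {(x, x) | x. x \<in> space M} \<inter> space (M \<Otimes>\<^sub>M M)
      = {(x, g x) | x. x \<in> space M}"
    using gs by (auto simp: space_pair_measure)
  finally show "{(x, g x) | x. x \<in> space M} \<in> sets (M \<Otimes>\<^sub>M M)" .
qed

lemma pmp_equiv_rel_measurable:
  assumes "standard_borel M" "pmp_equiv_rel M R"
  shows "R \<in> sets (M \<Otimes>\<^sub>M M)"
proof -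
  obtain g :: "nat \<Rightarrow> 'a \<Rightarrow> 'a" where g: "\<And>i. g i \<in> M \<rightarrow>\<^sub>M M" "\<And>i. distr M M (g i) = M"
    "R = {(x, g i x) | x i. x \<in> space M}"
    using pmp_equiv_rel_enum[OF assms(2)] by blast
  have "R = (\<Union>i. {(x, g i x) | x. x \<in> space M})" unfolding g(3) by auto
  also have "\<dots> \<in> sets (M \<Otimes>\<^sub>M M)"
    using graph_measurable(2)[OF assms(1) g(1) g(1)] by auto
  finally show ?thesis .
qed

lemma section_count_measurable:
  assumes "standard_borel M" "pmp_equiv_rel M R" "A \<in> sets (M \<Otimes>\<^sub>M M)" "A \<subseteq> R"
  shows "(\<lambda>x. emeasure (count_space UNIV) (A `` {x})) \<in> borel_measurable M"
proof -
  obtain g :: "nat \<Rightarrow> 'a \<Rightarrow> 'a" where g: "\<And>i. g i \<in> M \<rightarrow>\<^sub>M M" "\<And>i. distr M M (g i) = M"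
    "R = {(x, g i x) | x i. x \<in> space M}"
    using pmp_equiv_rel_enum[OF assms(2)] by blast
  note [measurable] = g(1) assms(3)
  have [measurable]: "{x \<in> space M. g i x = g j x} \<in> sets M" for i j
    using graph_measurable(1)[OF assms(1) g(1) g(1)] .
  have [measurable]: "Measurable.pred M (\<lambda>x. g i x = g j x)" for i j
    by (simp add: pred_def)
  define D where "D i = {x \<in> space M. (x, g i x) \<in> A \<and> (\<forall>j<i. g j x \<noteq> g i x)}" for i
  have D: "D i \<in> sets M" for i unfolding D_def by measurable
  have "emeasure (count_space UNIV) (A `` {x}) = (\<Sum>i. indicator (D i) x)"
    if x: "x \<in> space M" for x
  proof -
    define E where "E i = (if x \<in> D i then {g i x} else {})" for i
    have "A `` {x} = (\<Union>i. E i)"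
    proof (intro equalityI subsetI)
      fix y assume "y \<in> A `` {x}"
      then have yA: "(x, y) \<in> A" by auto
      then have ex: "\<exists>i. g i x = y" using assms(4) g(3) by auto
      define i where "i = (LEAST i. g i x = y)"
      have "g i x = y" using LeastI_ex[OF ex] by (simp add: i_def)
      moreover have "\<forall>j<i. g j x \<noteq> y" using not_less_Least i_def by blast
      ultimately have "y \<in> E i" using yA x by (auto simp: E_def D_def)
      then show "y \<in> (\<Union>i. E i)" by blast
    qed (auto simp: E_def D_def split: if_splits)
    moreover have "disjoint_family E"
      unfolding disjoint_family_on_def E_def D_def
      by (auto split: if_splits) (metis nat_neq_iff)
    ultimately have "emeasure (count_space UNIV) (A `` {x})
        = (\<Sum>i. emeasure (count_space UNIV) (E i))"
      by (simp add: suminf_emeasure)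
    also have "\<dots> = (\<Sum>i. indicator (D i) x)"
      by (intro suminf_cong) (auto simp: E_def)
    finally show ?thesis .
  qed
  then show ?thesis
    by (subst measurable_cong) (auto intro!: borel_measurable_suminf_order borel_measurable_indicator D)
qed

lemma
  assumes "standard_borel M" "pmp_equiv_rel M R"
  shows space_rel_measure: "space (rel_measure M R) = R"
    and sets_rel_measure: "sets (rel_measure M R) = {A \<in> sets (M \<Otimes>\<^sub>M M). A \<subseteq> R}"
    and emeasure_rel_measure: "\<And>A. A \<in> sets (M \<Otimes>\<^sub>M M) \<Longrightarrow> A \<subseteq> R \<Longrightarrow>
      emeasure (rel_measure M R) A = (\<integral>\<^sup>+x. emeasure (count_space UNIV) (A `` {x}) \<partial>M)"
proof -
  let ?S = "{A \<in> sets (M \<Otimes>\<^sub>M M). A \<subseteq> R}"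
  have R: "R \<in> sets (M \<Otimes>\<^sub>M M)" by (rule pmp_equiv_rel_measurable[OF assms])
  have "?S = {R \<inter> A | A. A \<in> sets (M \<Otimes>\<^sub>M M)}"
  proof (intro equalityI subsetI)
    fix A assume "A \<in> ?S"
    then show "A \<in> {R \<inter> A | A. A \<in> sets (M \<Otimes>\<^sub>M M)}" by (auto intro: exI[of _ A])
  qed (use R in auto)
  then have "?S = sets (restrict_space (M \<Otimes>\<^sub>M M) R)" by (auto simp: sets_restrict_space)
  moreover have "space (restrict_space (M \<Otimes>\<^sub>M M) R) = R"
    using sets.sets_into_space[OF R] by (auto simp: space_restrict_space)
  ultimately have sa: "sigma_algebra R ?S"
    using sets.sigma_algebra_axioms[of "restrict_space (M \<Otimes>\<^sub>M M) R"] by metis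
  show "space (rel_measure M R) = R"
    unfolding rel_measure_def by (rule space_measure_of) auto
  show S: "sets (rel_measure M R) = ?S"
    unfolding rel_measure_def by (rule sigma_algebra.sets_measure_of_eq[OF sa])
  fix A assume A: "A \<in> sets (M \<Otimes>\<^sub>M M)" "A \<subseteq> R"
  show "emeasure (rel_measure M R) A = (\<integral>\<^sup>+x. emeasure (count_space UNIV) (A `` {x}) \<partial>M)"
    unfolding rel_measure_def
  proof (rule emeasure_measure_of_sigma[OF sa])
    show "positive ?S (\<lambda>A. \<integral>\<^sup>+x. emeasure (count_space UNIV) (A `` {x}) \<partial>M)"
      by (simp add: positive_def)
    show "countably_additive ?S (\<lambda>A. \<integral>\<^sup>+x. emeasure (count_space UNIV) (A `` {x}) \<partial>M)"
    proof (rule countably_additiveI)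
      fix F :: "nat \<Rightarrow> ('a \<times> 'a) set"
      assume F: "range F \<subseteq> ?S" "disjoint_family F" "(\<Union>i. F i) \<in> ?S"
      have "(\<Sum>i. \<integral>\<^sup>+x. emeasure (count_space UNIV) (F i `` {x}) \<partial>M)
          = (\<integral>\<^sup>+x. (\<Sum>i. emeasure (count_space UNIV) (F i `` {x})) \<partial>M)"
        by (rule nn_integral_suminf[symmetric])
           (use F(1) in \<open>auto intro!: section_count_measurable[OF assms]\<close>)
      also have "\<dots> = (\<integral>\<^sup>+x. emeasure (count_space UNIV) ((\<Union>i. F i) `` {x}) \<partial>M)"
      proof (rule nn_integral_cong)
        fix x
        have "disjoint_family (\<lambda>i. F i `` {x})"
          using F(2) unfolding disjoint_family_on_def by blast
        then have "(\<Sum>i. emeasure (count_space UNIV) (F i `` {x}))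
            = emeasure (count_space UNIV) (\<Union>i. F i `` {x})"
          by (intro suminf_emeasure) auto
        also have "(\<Union>i. F i `` {x}) = (\<Union>i. F i) `` {x}" by auto
        finally show "(\<Sum>i. emeasure (count_space UNIV) (F i `` {x}))
            = emeasure (count_space UNIV) ((\<Union>i. F i) `` {x})" .
      qed
      finally show "(\<Sum>i. \<integral>\<^sup>+x. emeasure (count_space UNIV) (F i `` {x}) \<partial>M)
          = (\<integral>\<^sup>+x. emeasure (count_space UNIV) ((\<Union>i. F i) `` {x}) \<partial>M)" .
    qed
    show "A \<in> ?S" using A by simp
  qed
qed

lemma ex_finite_equivalent_measure:
  assumes "prob_space M" "standard_borel M" "pmp_equiv_rel M R"
  shows "\<exists>m. finite_measure m \<and> equivalent_measures m (rel_measure M R)"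
proof -
  interpret prob_space M by (rule assms(1))
  let ?N = "rel_measure M R"
  obtain g :: "nat \<Rightarrow> 'a \<Rightarrow> 'a" where g: "\<And>i. g i \<in> M \<rightarrow>\<^sub>M M" "\<And>i. distr M M (g i) = M"
    "R = {(x, g i x) | x i. x \<in> space M}"
    using pmp_equiv_rel_enum[OF assms(3)] by blast
  define \<Gamma> where "\<Gamma> i = {(x, g i x) | x. x \<in> space M}" for i
  have \<Gamma>: "\<Gamma> i \<in> sets (M \<Otimes>\<^sub>M M)" "\<Gamma> i \<subseteq> R" for i
    using graph_measurable(2)[OF assms(2) g(1) g(1)] by (auto simp: \<Gamma>_def g(3))
  have "emeasure ?N (\<Gamma> i) \<noteq> \<infinity>" for i
  proof -
    have "emeasure ?N (\<Gamma> i) = (\<integral>\<^sup>+x. emeasure (count_space UNIV) (\<Gamma> i `` {x}) \<partial>M)"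
      by (rule emeasure_rel_measure[OF assms(2,3) \<Gamma>])
    also have "\<dots> = (\<integral>\<^sup>+x. 1 \<partial>M)"
    proof (rule nn_integral_cong)
      fix x assume "x \<in> space M"
      then have "\<Gamma> i `` {x} = {g i x}" by (auto simp: \<Gamma>_def)
      then show "emeasure (count_space UNIV) (\<Gamma> i `` {x}) = 1" by simp
    qed
    finally show ?thesis by (simp add: emeasure_space_1)
  qed
  moreover have "R = (\<Union>i. \<Gamma> i)" by (auto simp: \<Gamma>_def g(3))
  ultimately have "sigma_finite_measure ?N"
    using \<Gamma> space_rel_measure[OF assms(2,3)] sets_rel_measure[OF assms(2,3)]
    by (intro sigma_finite_measure.intro exI[of _ "range \<Gamma>"]) auto
  then obtain h where h: "h \<in> borel_measurable ?N" "integral\<^sup>N ?N h \<noteq> \<infinity>"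
    "\<And>x. x \<in> space ?N \<Longrightarrow> 0 < h x"
    using sigma_finite_measure.Ex_finite_integrable_function by blast
  have "finite_measure (density ?N h)"
  proof (rule finite_measureI)
    have "emeasure (density ?N h) (space ?N) = (\<integral>\<^sup>+x. h x * indicator (space ?N) x \<partial>?N)"
      by (rule emeasure_density) (use h in auto)
    also have "\<dots> = integral\<^sup>N ?N h" by (rule nn_integral_cong) auto
    finally show "emeasure (density ?N h) (space (density ?N h)) \<noteq> \<infinity>" using h by simp
  qed
  moreover have "A \<in> null_sets (density ?N h) \<longleftrightarrow> A \<in> null_sets ?N" for A
  proof
    assume "A \<in> null_sets (density ?N h)"
    then have A: "A \<in> sets ?N" "AE x in ?N. x \<in> A \<longrightarrow> h x = 0"
      using h(1) by (auto simp: null_sets_density_iff)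
    have "AE x in ?N. x \<notin> A" using A(2) AE_space by eventually_elim (use h(3) in force)
    then show "A \<in> null_sets ?N" using A(1) by (simp add: AE_iff_null_sets)
  next
    assume "A \<in> null_sets ?N"
    then show "A \<in> null_sets (density ?N h)"
      using absolutely_continuousI_density[OF h(1)] by (auto simp: absolutely_continuous_def)
  qed
  ultimately show ?thesis
    by (intro exI[of _ "density ?N h"])
       (auto simp: equivalent_measures_def absolutely_continuous_def)
qed

end

theory Submission
  imports Defs
begin

text \<open>A hyperfinite relation is an increasing union of relations \<open>F\<close> with finite classes, and \<open>R\<close> is an
  increasing union of symmetric locally finite sets \<open>K\<close>, so it suffices to find, for given \<open>F\<close> and
  \<open>K\<close>, some \<open>T\<close> in the full group such that \<open>T \<cdot> S\<close> and \<open>F\<close> agree on \<open>K\<close> almost everywhere.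
  The inverse of \<open>T\<close> is built by a greedy matching in countably many steps: whole \<open>F\<close>-classes are
  sent injectively into single \<open>S\<close>-classes, avoiding the \<open>S\<close>-classes of the images of all
  \<open>K\<close>-neighbours outside the \<open>F\<close>-class which have been matched before.  The matched points and
  their images have the same measure.  If the set \<open>Y\<close> of unused targets had positive measure, then
  by ergodicity and infinite index almost every \<open>R\<close>-class would meet infinitely many \<open>S\<close>-classes
  in \<open>Y\<close>, and in infinite sets by aperiodicity; as only finitely many \<open>S\<close>-classes are forbidden,
  almost every point would have been matched, a contradiction.\<close>

section \<open>P.m.p. equivalence relations\<close>

text \<open>The acting group is replaced by an enumeration \<open>g\<close> of its maps, possibly
  with repetitions. Inverses within the enumeration and \<open>R\<close> being an equivalence
  relation are what remains of the group structure. Quantifiers over an \<open>R\<close>-class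
  become quantifiers over indices, which keeps sets measurable.\<close>

locale pmp_relation = prob_space M
  for M :: "'a measure" and R :: "('a \<times> 'a) set" and g :: "nat \<Rightarrow> 'a \<Rightarrow> 'a" +
  assumes std: "standard_borel M"
    and pmp: "pmp_equiv_rel M R"
    and R_equiv: "equiv (space M) R"
    and R_eq: "R = {(x, g i x) | x i. x \<in> space M}"
    and g_measurable: "g i \<in> M \<rightarrow>\<^sub>M M"
    and g_distr: "distr M M (g i) = M"
    and g_inverse: "\<exists>j. \<forall>x\<in>space M. g j (g i x) = x"

lemma pmp_relation_ex:
  assumes "prob_space M" "standard_borel M" "pmp_equiv_rel M R"
  shows "\<exists>g. pmp_relation M R g"
proof -
  obtain G :: "nat monoid" and \<phi> where G: "group_action G (space M) \<phi>"
    "\<And>h. h \<in> carrier G \<Longrightarrow> \<phi> h \<in> M \<rightarrow>\<^sub>M M \<and> distr M M (\<phi> h) = M"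
    "R = {(x, \<phi> h x) | x h. x \<in> space M \<and> h \<in> carrier G}"
    using assms(3) unfolding pmp_equiv_rel_def by blast
  interpret group_action G "space M" \<phi> by (rule G(1))
  interpret G: group G using G(1) by (simp add: group_action_def group_hom_def)
  have ne: "carrier G \<noteq> {}" using G.one_closed by blast
  define g where "g i = \<phi> (from_nat_into (carrier G) i)" for i
  have gc: "from_nat_into (carrier G) i \<in> carrier G" for i by (rule from_nat_into[OF ne])
  have gs: "\<exists>i. g i = \<phi> h" if "h \<in> carrier G" for h
    unfolding g_def by (metis that from_nat_into_surj countableI_type)
  have one: "\<phi> \<one>\<^bsub>G\<^esub> x = x" if "x \<in> space M" for x
    using id_eq_one that by (metis restrict_apply')
  have comp: "\<phi> h (\<phi> k x) = \<phi> (h \<otimes>\<^bsub>G\<^esub> k) x" if "x \<in> space M" "h \<in> carrier G" "k \<in> carrier G" for x h k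
    using composition_rule that by simp
  have inv: "\<phi> (inv\<^bsub>G\<^esub> h) (\<phi> h x) = x" if "x \<in> space M" "h \<in> carrier G" for x h
    using that by (simp add: comp one)
  have sp: "\<phi> h x \<in> space M" if "x \<in> space M" "h \<in> carrier G" for x h
    using element_image that by blast
  have R: "R = {(x, g i x) | x i. x \<in> space M}"
    unfolding G(3) using gs gc by (auto simp: g_def) metis
  have "equiv (space M) R"
  proof (rule equivI)
    show "R \<subseteq> space M \<times> space M" unfolding G(3) using sp by auto
    show "refl_on (space M) R"
    proof (rule refl_onI)
      fix x assume "x \<in> space M"
      then have "x = \<phi> \<one>\<^bsub>G\<^esub> x" "x \<in> space M" using one by auto
      then show "(x, x) \<in> R" unfolding G(3) using G.one_closed by blast
    qed
    show "sym R"
    proof (rule symI)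
      fix x y assume "(x, y) \<in> R"
      then obtain h where h: "x \<in> space M" "h \<in> carrier G" "y = \<phi> h x" unfolding G(3) by auto
      have "x = \<phi> (inv\<^bsub>G\<^esub> h) y" "y \<in> space M" "inv\<^bsub>G\<^esub> h \<in> carrier G"
        using h inv[OF h(1,2)] sp[OF h(1,2)] by auto
      then show "(y, x) \<in> R" unfolding G(3) by blast
    qed
    show "trans R"
    proof (rule transI)
      fix x y z assume "(x, y) \<in> R" "(y, z) \<in> R"
      then obtain h k where "x \<in> space M" "h \<in> carrier G" "y = \<phi> h x" "k \<in> carrier G" "z = \<phi> k y"
        unfolding G(3) by auto
      then have "x \<in> space M" "z = \<phi> (k \<otimes>\<^bsub>G\<^esub> h) x" "k \<otimes>\<^bsub>G\<^esub> h \<in> carrier G"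
        by (auto simp: comp)
      then show "(x, z) \<in> R" unfolding G(3) by blast
    qed
  qed
  moreover have "\<exists>j. \<forall>x\<in>space M. g j (g i x) = x" for i
    using gs[OF G.inv_closed[OF gc[of i]]] inv gc by (metis g_def)
  ultimately have "pmp_relation M R g"
    using assms R G(2) gc unfolding pmp_relation_def pmp_relation_axioms_def g_def by blast
  then show ?thesis by blast
qed

context pmp_relation
begin

declare g_measurable [measurable]

abbreviation "N \<equiv> rel_measure M R"

lemma g_space: "x \<in> space M \<Longrightarrow> g i x \<in> space M"
  using measurable_space[OF g_measurable] .

lemma g_in_R: "x \<in> space M \<Longrightarrow> (x, g i x) \<in> R"
  unfolding R_eq by blast

lemma g_inj: "x \<in> space M \<Longrightarrow> y \<in> space M \<Longrightarrow> g i x = g i y \<Longrightarrow> x = y"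
  using g_inverse[of i] by metis

lemma R_obtain:
  assumes "(x, y) \<in> R" obtains i where "y = g i x"
  using assms unfolding R_eq by blast

lemma R_space: "(x, y) \<in> R \<Longrightarrow> x \<in> space M \<and> y \<in> space M"
  using R_equiv by (auto simp: equiv_def)

lemma R_refl: "x \<in> space M \<Longrightarrow> (x, x) \<in> R"
  using R_equiv by (meson equivE refl_onD)

lemma R_sym: "(x, y) \<in> R \<Longrightarrow> (y, x) \<in> R"
  using R_equiv by (meson equivE symE)

lemma R_trans: "(x, y) \<in> R \<Longrightarrow> (y, z) \<in> R \<Longrightarrow> (x, z) \<in> R"
  using R_equiv by (meson equivE transE)

lemma R_sets [measurable]: "R \<in> sets (M \<Otimes>\<^sub>M M)"
  by (rule pmp_equiv_rel_measurable[OF std pmp])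

lemma diagonal_sets: "Id_on (space M) \<in> sets (M \<Otimes>\<^sub>M M)"
proof -
  have "Id_on (space M) = {(x, x) | x. x \<in> space M}" by auto
  then show ?thesis using standard_borel_diagonal[OF std] by simp
qed

lemma g_eq_pred [measurable]: "Measurable.pred M (\<lambda>x. g i x = g j x)"
  using graph_measurable(1)[OF std g_measurable g_measurable] by (simp add: pred_def)

section \<open>Borel sets and mass transport inside \<open>R\<close>\<close>

lemma sets_N: "A \<in> sets N \<longleftrightarrow> A \<in> sets (M \<Otimes>\<^sub>M M) \<and> A \<subseteq> R"
  using sets_rel_measure[OF std pmp] by auto

lemma sets_converse:
  assumes "A \<in> sets (M \<Otimes>\<^sub>M M)"
  shows "A\<inverse> \<in> sets (M \<Otimes>\<^sub>M M)"
proof -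
  have "(\<lambda>(x, y). (y, x)) -` A \<inter> space (M \<Otimes>\<^sub>M M) \<in> sets (M \<Otimes>\<^sub>M M)"
    by (rule measurable_sets[OF measurable_pair_swap' assms])
  also have "(\<lambda>(x, y). (y, x)) -` A \<inter> space (M \<Otimes>\<^sub>M M) = A\<inverse>"
    using sets.sets_into_space[OF assms] by (auto simp: space_pair_measure)
  finally show ?thesis .
qed

lemma sets_N_converse: "A \<in> sets N \<Longrightarrow> A\<inverse> \<in> sets N"
  using sets_converse R_sym by (auto simp: sets_N)

text \<open>Projections of Borel sets need not be Borel, but inside \<open>R\<close> a set is a
  countable union of pieces lying on the graphs of the \<open>g i\<close>.\<close>

lemma sets_Domain:
  assumes "A \<in> sets N" shows "Domain A \<in> sets M"
proof -
  have [measurable]: "A \<in> sets (M \<Otimes>\<^sub>M M)" using assms by (simp add: sets_N)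
  have "Domain A = (\<Union>i. {x \<in> space M. (x, g i x) \<in> A})"
  proof (intro equalityI subsetI)
    fix x assume "x \<in> Domain A"
    then obtain y where y: "(x, y) \<in> A" by blast
    then have R: "(x, y) \<in> R" using assms by (auto simp: sets_N)
    then obtain i where "y = g i x" by (rule R_obtain)
    then show "x \<in> (\<Union>i. {x \<in> space M. (x, g i x) \<in> A})" using y R_space[OF R] by auto
  qed auto
  also have "\<dots> \<in> sets M" by measurable
  finally show ?thesis .
qed

lemma sets_Range: "A \<in> sets N \<Longrightarrow> Range A \<in> sets M"
  using sets_Domain[OF sets_N_converse] by simp

lemma emeasure_single_valued:
  assumes "A \<in> sets N" "single_valued A"
  shows "emeasure N A = emeasure M (Domain A)"
proof -
  have "emeasure N A = (\<integral>\<^sup>+x. emeasure (count_space UNIV) (A `` {x}) \<partial>M)"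
    by (rule emeasure_rel_measure[OF std pmp]) (use assms in \<open>auto simp: sets_N\<close>)
  also have "\<dots> = (\<integral>\<^sup>+x. indicator (Domain A) x \<partial>M)"
  proof (rule nn_integral_cong)
    fix x
    show "emeasure (count_space UNIV) (A `` {x}) = indicator (Domain A) x"
    proof (cases "x \<in> Domain A")
      case True
      then obtain y where "(x, y) \<in> A" by blast
      then have "A `` {x} = {y}" using assms(2) by (auto simp: single_valued_def)
      then show ?thesis using True by simp
    next
      case False
      then have "A `` {x} = {}" by blast
      then show ?thesis using False by simp
    qed
  qed
  finally show ?thesis using sets_Domain[OF assms(1)] by simp
qed

text \<open>It suffices to compare the two measures on the pieces of \<open>A\<close> lying on the graph of
  a single \<open>g i\<close>, and there both equal the measure of the projection.\<close>

lemma emeasure_converse: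
  assumes "A \<in> sets N"
  shows "emeasure N (A\<inverse>) = emeasure N A"
proof -
  define \<Gamma> where "\<Gamma> i = {(x, g i x) | x. x \<in> space M}" for i
  have \<Gamma>: "\<Gamma> i \<in> sets N" for i
    using graph_measurable(2)[OF std g_measurable g_measurable] g_in_R by (auto simp: sets_N \<Gamma>_def)
  define B where "B i = A \<inter> disjointed \<Gamma> i" for i
  have sets_B: "B i \<in> sets N" for i
    using sets.range_disjointed_sets[of \<Gamma> N] \<Gamma> assms by (auto simp: B_def)
  have dis: "disjoint_family B"
    using disjoint_family_disjointed[of \<Gamma>] unfolding disjoint_family_on_def B_def by blast
  have un: "A = (\<Union>i. B i)"
  proof -
    have "R = (\<Union>i. \<Gamma> i)" unfolding \<Gamma>_def by (subst R_eq) auto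
    moreover have "A \<subseteq> R" using assms sets_N by blast
    ultimately have "A \<subseteq> (\<Union>i. \<Gamma> i)" by blast
    then show ?thesis by (auto simp: B_def simp flip: UN_disjointed_eq[of \<Gamma>])
  qed
  have piece: "emeasure N ((B i)\<inverse>) = emeasure N (B i)" for i
  proof -
    have sub: "B i \<subseteq> \<Gamma> i" using disjointed_subset[of \<Gamma> i] by (auto simp: B_def)
    then have B: "x \<in> space M \<and> y = g i x" if "(x, y) \<in> B i" for x y
      using that by (auto simp: \<Gamma>_def)
    have sv: "single_valued (B i)" "single_valued ((B i)\<inverse>)"
    proof (rule_tac [!] single_valuedI)
      show "y = z" if "(x, y) \<in> B i" "(x, z) \<in> B i" for x y z
        using B[OF that(1)] B[OF that(2)] by simp
      show "y = z" if "(x, y) \<in> (B i)\<inverse>" "(x, z) \<in> (B i)\<inverse>" for x y z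
      proof (rule g_inj)
        show "y \<in> space M" "z \<in> space M" "g i y = g i z" using B that by (metis converseD)+
      qed
    qed
    \<comment> \<open>Injectivity of \<open>g i\<close> turns the preimage of the range into the
      domain, so that invariance of \<open>M\<close> under \<open>g i\<close> compares the two
      projections.\<close>
    have "g i -` Range (B i) \<inter> space M = Domain (B i)"
    proof (intro equalityI subsetI)
      fix x assume "x \<in> g i -` Range (B i) \<inter> space M"
      then obtain z where z: "x \<in> space M" "(z, g i x) \<in> B i" by auto
      then have "z \<in> space M" "g i x = g i z" using sub by (auto simp: \<Gamma>_def)
      then have "z = x" using g_inj z(1) by metis
      then show "x \<in> Domain (B i)" using z(2) by blast
    next
      fix x assume "x \<in> Domain (B i)"
      then obtain y where y: "(x, y) \<in> B i" by blast
      then have "x \<in> space M" "y = g i x" using sub by (auto simp: \<Gamma>_def)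
      then show "x \<in> g i -` Range (B i) \<inter> space M" using y by auto
    qed
    moreover have "emeasure M (Range (B i)) = emeasure (distr M M (g i)) (Range (B i))"
      by (simp add: g_distr)
    ultimately have "emeasure M (Range (B i)) = emeasure M (Domain (B i))"
      by (simp add: emeasure_distr sets_Range[OF sets_B])
    then show ?thesis
      using emeasure_single_valued[OF sets_B sv(1)]
        emeasure_single_valued[OF sets_N_converse[OF sets_B] sv(2)] by simp
  qed
  have "disjoint_family (\<lambda>i. (B i)\<inverse>)" using dis unfolding disjoint_family_on_def by blast
  then have "emeasure N (\<Union>i. (B i)\<inverse>) = (\<Sum>i. emeasure N ((B i)\<inverse>))"
    using sets_N_converse[OF sets_B] by (intro suminf_emeasure[symmetric]) auto
  also have "\<dots> = emeasure N A"
    unfolding piece un using sets_B dis by (intro suminf_emeasure) auto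
  finally show ?thesis unfolding un by (simp add: converse_UNION)
qed

text \<open>Both projections have the mass of \<open>A\<close>, counted along rows or along columns.
  For the matching this says that matched points and used targets are equally many.\<close>

lemma emeasure_Domain_eq_Range:
  assumes "A \<in> sets N" "single_valued A" "single_valued (A\<inverse>)"
  shows "emeasure M (Domain A) = emeasure M (Range A)"
  using emeasure_single_valued[OF assms(1,2)] emeasure_converse[OF assms(1)]
    emeasure_single_valued[OF sets_N_converse[OF assms(1)] assms(3)] by simp

section \<open>Moving along \<open>R\<close>-classes and discarding null sets\<close>

lemma R_symD: "x \<in> space M \<Longrightarrow> (g i x, x) \<in> R"
  using R_sym[OF g_in_R] .

lemma R_gg: "x \<in> space M \<Longrightarrow> (g i x, g j x) \<in> R"
  using R_trans[OF R_symD g_in_R] .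

lemma R_obtain_g:
  assumes "x \<in> space M" "(g i x, y) \<in> R" obtains j where "y = g j x"
  using R_trans[OF g_in_R[OF assms(1)] assms(2)] R_obtain by blast

text \<open>The left inverse \<open>g j\<close> of \<open>g i\<close> has a left inverse
  \<open>g l\<close> in turn, which forces \<open>g j\<close> to be two-sided.\<close>

lemma g_inverse_both:
  obtains j where "\<And>x. x \<in> space M \<Longrightarrow> g j (g i x) = x" "\<And>x. x \<in> space M \<Longrightarrow> g i (g j x) = x"
proof -
  obtain j where j: "\<And>x. x \<in> space M \<Longrightarrow> g j (g i x) = x" using g_inverse by blast
  obtain l where l: "\<And>x. x \<in> space M \<Longrightarrow> g l (g j x) = x" using g_inverse by blast
  have "g i (g j x) = x" if x: "x \<in> space M" for x
  proof -
    have "g i (g j x) = g l (g j (g i (g j x)))" using l g_space x by simp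
    also have "\<dots> = x" using j l g_space x by simp
    finally show ?thesis .
  qed
  then show thesis using j that by blast
qed

lemma g_eq_id_pred [measurable]: "Measurable.pred M (\<lambda>x. g i x = x)"
  using graph_measurable(1)[OF std g_measurable, of "\<lambda>x. x"] by (simp add: pred_def)

text \<open>The exceptional set has only countably many preimages under the \<open>g i\<close>, all
  of them null by invariance of the measure.\<close>

lemma AE_saturated:
  assumes "AE x in M. \<phi> x"
  shows "AE x in M. \<forall>y. (x, y) \<in> R \<longrightarrow> \<phi> y"
proof -
  have "AE x in M. \<phi> (g i x)" for i
  proof (rule AE_distrD[OF g_measurable])
    show "AE x in distr M M (g i). \<phi> x" unfolding g_distr by (rule assms)
  qed
  then have "AE x in M. \<forall>i. \<phi> (g i x)" by (simp add: AE_all_countable)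
  then show ?thesis by eventually_elim (auto elim: R_obtain)
qed

text \<open>The points whose whole \<open>R\<close>-class lies in \<open>A\<close> form an invariant
  set, conull by \<open>AE_saturated\<close>.\<close>

lemma conull_invariant_subset:
  assumes "A \<in> sets M" "space M - A \<in> null_sets M"
  obtains B where "B \<in> sets M" "B \<subseteq> A" "space M - B \<in> null_sets M" "\<And>x y. (x, y) \<in> R \<Longrightarrow> x \<in> B \<Longrightarrow> y \<in> B"
proof -
  define B where "B = {x \<in> space M. \<forall>i. g i x \<in> A}"
  have [measurable]: "A \<in> sets M" by (rule assms)
  have B: "B \<in> sets M" unfolding B_def by measurable
  have sat: "x \<in> B \<longleftrightarrow> x \<in> space M \<and> (\<forall>y. (x, y) \<in> R \<longrightarrow> y \<in> A)" for x
    unfolding B_def using g_in_R by (auto elim: R_obtain)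
  have "AE x in M. x \<in> A"
    using AE_not_in[OF assms(2)] by (rule AE_mp) auto
  from AE_saturated[OF this] have "AE x in M. x \<in> B"
    using AE_space by eventually_elim (auto simp: sat)
  then have "AE x in M. x \<notin> space M - B" by eventually_elim auto
  then have null: "space M - B \<in> null_sets M"
    using B by (subst (asm) AE_iff_null_sets[symmetric]) auto
  have sub: "B \<subseteq> A" using sat R_refl by auto
  have inv: "y \<in> B" if "(x, y) \<in> R" "x \<in> B" for x y
    using that R_space R_trans unfolding sat by blast
  show thesis by (rule that[OF B sub null inv])
qed

text \<open>This passes from null sets of points to null sets of pairs: over an invariant conull
  part of \<open>Z\<close> the sections of \<open>A\<close> stay inside \<open>Z\<close>, hence are
  empty.\<close>

lemma null_sets_N_off_conull:
  assumes "A \<in> sets N" "Z \<in> sets M" "space M - Z \<in> null_sets M"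
    and "\<And>x y. (x, y) \<in> A \<Longrightarrow> x \<in> Z \<Longrightarrow> y \<in> Z \<Longrightarrow> False"
  shows "A \<in> null_sets N"
proof -
  obtain B where B: "B \<in> sets M" "B \<subseteq> Z" "space M - B \<in> null_sets M"
    "\<And>x y. (x, y) \<in> R \<Longrightarrow> x \<in> B \<Longrightarrow> y \<in> B"
    using conull_invariant_subset[OF assms(2,3)] by blast
  have A: "A \<in> sets (M \<Otimes>\<^sub>M M)" "A \<subseteq> R" using assms(1) sets_N by auto
  have "emeasure N A = (\<integral>\<^sup>+x. emeasure (count_space UNIV) (A `` {x}) \<partial>M)"
    by (rule emeasure_rel_measure[OF std pmp A])
  also have "\<dots> = (\<integral>\<^sup>+x. 0 \<partial>M)"
  proof (rule nn_integral_cong_AE)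
    show "AE x in M. emeasure (count_space UNIV) (A `` {x}) = 0"
      using AE_not_in[OF B(3)] AE_space
    proof eventually_elim
      case (elim x)
      then have "A `` {x} = {}" using A(2) B(2,4) assms(4) by blast
      then show ?case by simp
    qed
  qed
  finally show ?thesis using assms(1) by (auto simp: null_sets_def)
qed

section \<open>Finite signatures of points, and recurrence for aperiodic relations\<close>

lemma signature_ex:
  "\<exists>c :: nat \<Rightarrow> 'a \<Rightarrow> nat. (\<forall>n. c n \<in> M \<rightarrow>\<^sub>M count_space UNIV) \<and>
     (\<forall>x\<in>space M. \<forall>y\<in>space M. x \<noteq> y \<longrightarrow> (\<exists>n0. \<forall>n\<ge>n0. c n x \<noteq> c n y))"
proof -
  obtain T where T: "completely_metrizable_space T" "second_countable T"
    "topspace T = space M" "sets M = sigma_sets (space M) {U. openin T U}"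
    using std by (auto simp: standard_borel_def)
  have haus: "Hausdorff_space T"
    using T(1) completely_metrizable_imp_metrizable_space metrizable_imp_Hausdorff_space by blast
  obtain \<B> where \<B>: "countable \<B>" "\<And>V. V \<in> \<B> \<Longrightarrow> openin T V"
    "\<And>U x. openin T U \<Longrightarrow> x \<in> U \<Longrightarrow> \<exists>V\<in>\<B>. x \<in> V \<and> V \<subseteq> U"
    using T(2) unfolding second_countable_def by metis
  \<comment> \<open>Adding the empty set ensures that there is something to enumerate.\<close>
  define U where "U = from_nat_into (insert {} \<B>)"
  have U: "range U = insert {} \<B>" unfolding U_def using \<B>(1) by (intro range_from_nat_into) auto
  have Us [measurable]: "U n \<in> sets M" for n
  proof -
    have "U n \<in> insert {} \<B>" using U by blast
    then show ?thesis using T(4) \<B>(2) by auto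
  qed
  \<comment> \<open>\<open>c n x\<close> codes in binary which of the first \<open>n\<close> basic
    sets contain \<open>x\<close>. Appending digits never merges distinct codes, so two points
    remain separated once a basic set has told them apart.\<close>
  define c where "c = rec_nat (\<lambda>_. 0 :: nat) (\<lambda>n f x. 2 * f x + (if x \<in> U n then 1 else 0))"
  have c: "c 0 = (\<lambda>_. 0)" "c (Suc n) = (\<lambda>x. 2 * c n x + (if x \<in> U n then 1 else 0))" for n
    by (simp_all add: c_def)
  have meas: "c n \<in> M \<rightarrow>\<^sub>M count_space UNIV" for n
  proof (induction n)
    case (Suc n)
    have "(\<lambda>x. (\<lambda>k x. 2 * k + (if x \<in> U n then 1 else 0 :: nat)) (c n x) x) \<in> M \<rightarrow>\<^sub>M count_space UNIV"
      by (rule measurable_compose_countable[OF _ Suc]) measurable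
    then show ?case by (simp add: c)
  qed (simp add: c)
  have sep: "\<exists>n0. \<forall>n\<ge>n0. c n x \<noteq> c n y" if xy: "x \<in> space M" "y \<in> space M" "x \<noteq> y" for x y
  proof -
    obtain V W where "openin T V" "openin T W" "x \<in> V" "y \<in> W" "disjnt V W"
      using haus xy T(3) unfolding Hausdorff_space_def by metis
    then obtain V' where "V' \<in> \<B>" "x \<in> V'" "y \<notin> V'"
      using \<B>(3)[of V x] unfolding disjnt_def by blast
    then obtain k where k: "x \<in> U k" "y \<notin> U k" using U by (metis insertI2 imageE)
    have "c n x \<noteq> c n y" if "n \<ge> Suc k" for n
      using that
    proof (induction n rule: dec_induct)
      case base then show ?case using k by (simp add: c) presburger
    next
      case (step n) then show ?case by (simp add: c)
    qed
    then show ?thesis by blast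
  qed
  show ?thesis using meas sep by blast
qed

lemma finite_signature:
  fixes c :: "nat \<Rightarrow> 'a \<Rightarrow> nat"
  assumes sep: "\<And>x y. x \<in> space M \<Longrightarrow> y \<in> space M \<Longrightarrow> x \<noteq> y \<Longrightarrow> \<exists>n0. \<forall>n\<ge>n0. c n x \<noteq> c n y"
    and "finite A" "A \<subseteq> space M"
  shows "\<forall>\<^sub>F n in sequentially. inj_on (c n) A"
proof -
  have "\<forall>\<^sub>F n in sequentially. x \<noteq> y \<longrightarrow> c n x \<noteq> c n y" if "x \<in> A" "y \<in> A" for x y
    using sep[of x y] that assms(3) by (cases "x = y") (auto simp: eventually_sequentially)
  then have "\<forall>\<^sub>F n in sequentially. \<forall>x\<in>A. \<forall>y\<in>A. x \<noteq> y \<longrightarrow> c n x \<noteq> c n y"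
    using assms(2) by (intro eventually_ball_finite ballI)
  then show ?thesis by eventually_elim (auto simp: inj_on_def)
qed

text \<open>Points of \<open>Y\<close> which are alone in their \<open>S\<close>-class with a given signature form a partial
  transversal \<open>Z\<close> of \<open>S\<close>: every point receives mass from at most one point of \<open>Z\<close>, whereas every
  point of \<open>Z\<close> sends out infinite mass, so \<open>Z\<close> is null.\<close>

lemma aperiodic_recurrent:
  assumes S: "S \<in> sets N" "equiv (space M) S" and ap: "aperiodic_rel M S" and Y: "Y \<in> sets M"
  shows "AE y in M. y \<in> Y \<longrightarrow> infinite (S `` {y} \<inter> Y)"
proof -
  obtain c :: "nat \<Rightarrow> 'a \<Rightarrow> nat" where c: "\<And>n. c n \<in> M \<rightarrow>\<^sub>M count_space UNIV"
    "\<And>x y. x \<in> space M \<Longrightarrow> y \<in> space M \<Longrightarrow> x \<noteq> y \<Longrightarrow> \<exists>n0. \<forall>n\<ge>n0. c n x \<noteq> c n y"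
    using signature_ex by blast
  note [measurable] = c(1) Y
  have S': "S \<in> sets (M \<Otimes>\<^sub>M M)" "S \<subseteq> R" using S(1) sets_N by auto
  note [measurable] = S'(1)
  define Z where "Z n v = {y \<in> space M. y \<in> Y \<and> c n y = v \<and>
    (\<forall>i. (y, g i y) \<in> S \<longrightarrow> g i y \<in> Y \<longrightarrow> \<not> g i y = y \<longrightarrow> c n (g i y) \<noteq> v)}" for n v
  have Zs: "Z n v \<in> sets M" for n v unfolding Z_def by measurable
  have "Z n v \<in> null_sets M" for n v
  proof -
    define A where "A = S \<inter> (Z n v \<times> space M)"
    have A: "A \<in> sets (M \<Otimes>\<^sub>M M)" "A \<subseteq> R" "A \<in> sets N"
      using Zs[of n v] S' by (auto simp: A_def sets_N)
    have sv: "single_valued (A\<inverse>)"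
    proof (rule single_valuedI)
      fix x y y' assume "(x, y) \<in> A\<inverse>" "(x, y') \<in> A\<inverse>"
      then have yy: "(y, x) \<in> S" "(y', x) \<in> S" "y \<in> Z n v" "y' \<in> Z n v" by (auto simp: A_def)
      then have yy': "(y, y') \<in> S" using S(2) by (meson equivE symE transE)
      then obtain i where "y' = g i y" using S'(2) R_obtain by blast
      then show "y = y'" using yy yy' by (auto simp: Z_def)
    qed
    have "emeasure N A = emeasure M (Range A)"
      using emeasure_converse[OF A(3)] emeasure_single_valued[OF sets_N_converse[OF A(3)] sv] by simp
    also have "\<dots> < \<infinity>" by (simp add: emeasure_eq_measure)
    finally have fin: "emeasure N A < \<infinity>" .
    have "emeasure N A = (\<integral>\<^sup>+x. emeasure (count_space UNIV) (A `` {x}) \<partial>M)"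
      by (rule emeasure_rel_measure[OF std pmp A(1,2)])
    also have "\<dots> = (\<integral>\<^sup>+x. \<infinity> * indicator (Z n v) x \<partial>M)"
    proof (rule nn_integral_cong_AE)
      show "AE x in M. emeasure (count_space UNIV) (A `` {x}) = \<infinity> * indicator (Z n v) x"
        using ap[unfolded aperiodic_rel_def] AE_space
      proof eventually_elim
        case (elim x)
        show ?case
        proof (cases "x \<in> Z n v")
          case True
          have "S `` {x} \<subseteq> space M" using S'(2) R_space by blast
          then have "A `` {x} = S `` {x}" using True by (auto simp: A_def)
          then show ?thesis using elim True by simp
        next
          case False
          then have "A `` {x} = {}" by (auto simp: A_def)
          then show ?thesis using False by simp
        qed
      qed
    qed
    also have "\<dots> = \<infinity> * emeasure M (Z n v)"
      by (rule nn_integral_cmult_indicator[OF Zs])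
    finally have "emeasure M (Z n v) = 0"
      using fin by (metis ennreal_top_mult infinity_ennreal_def less_irrefl)
    then show ?thesis using Zs by (auto simp: null_sets_def)
  qed
  then have "AE y in M. \<forall>n v. y \<notin> Z n v"
    by (auto simp: AE_all_countable intro: AE_not_in)
  then show ?thesis
    using AE_space
  proof eventually_elim
    case (elim y)
    show ?case
    proof (intro impI notI)
      assume y: "y \<in> Y" and fin: "finite (S `` {y} \<inter> Y)"
      \<comment> \<open>With finitely many companions in \<open>Y\<close>, some signature level
        tells \<open>y\<close> from all of them, which puts \<open>y\<close> into one of the null
        sets \<open>Z n v\<close>.\<close>
      let ?A = "insert y (S `` {y} \<inter> Y)"
      have "?A \<subseteq> space M" using elim S'(2) R_space by blast
      then have "\<forall>\<^sub>F n in sequentially. inj_on (c n) ?A"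
        using fin by (intro finite_signature[OF c(2)]) auto
      then obtain n where "inj_on (c n) ?A" by (auto simp: eventually_sequentially)
      then have "y \<in> Z n (c n y)" using y elim by (auto simp: Z_def inj_on_def)
      then show False using elim by blast
    qed
  qed
qed

section \<open>Supply of target classes from ergodicity and infinite index\<close>

lemma ergodic_meets:
  assumes "ergodic_rel M R" "Y \<in> sets M" "emeasure M Y > 0"
  shows "AE x in M. \<exists>y\<in>Y. (x, y) \<in> R"
proof -
  have "R \<inter> (Y \<times> space M) \<in> sets N"
    using assms(2) R_sets by (auto simp: sets_N)
  from sets_Range[OF this] have "Range (R \<inter> (Y \<times> space M)) \<in> sets M" .
  moreover have "Range (R \<inter> (Y \<times> space M)) = R `` Y" using R_space by blast
  ultimately have RY: "R `` Y \<in> sets M" by simp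
  have "R `` (R `` Y) \<subseteq> R `` Y" using R_trans by blast
  then have "R `` Y \<in> null_sets M \<or> space M - R `` Y \<in> null_sets M"
    using assms(1) RY unfolding ergodic_rel_def by blast
  moreover have "R `` Y \<notin> null_sets M"
  proof
    assume "R `` Y \<in> null_sets M"
    moreover have "Y \<subseteq> R `` Y" using R_refl sets.sets_into_space[OF assms(2)] by blast
    ultimately have "Y \<in> null_sets M" using null_sets_subset assms(2) by blast
    then show False using assms(3) by (auto simp: null_sets_def)
  qed
  ultimately have "space M - R `` Y \<in> null_sets M" by blast
  from AE_not_in[OF this] AE_space show ?thesis
    by eventually_elim (use R_sym in blast)
qed

text \<open>This supplies the targets of the matching; \<open>Q\<close> will consist of images whose
  \<open>S\<close>-classes are forbidden. By ergodicity almost every class meets \<open>Y\<close>,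
  and there it meets infinitely many traces of \<open>S\<close>-classes, of which each point of
  \<open>Q\<close> spoils only one. Recurrence makes the remaining traces infinite.\<close>

lemma many_infinite_classes:
  assumes erg: "ergodic_rel M R"
    and S: "S \<in> sets N" "equiv (space M) S" "aperiodic_rel M S" "everywhere_infinite_index M R S"
    and Y: "Y \<in> sets M" "emeasure M Y > 0"
  shows "AE x in M. \<forall>Q. finite Q \<longrightarrow>
    (\<exists>y\<in>Y. (x, y) \<in> R \<and> infinite (S `` {y} \<inter> Y) \<and> S `` {y} \<inter> Q = {})"
proof -
  have "AE y in M. y \<in> Y \<longrightarrow> infinite (((R \<inter> Y \<times> Y) `` {y}) // (S \<inter> Y \<times> Y))"
    using S(4) Y unfolding everywhere_infinite_index_def by blast
  from AE_saturated[OF this] AE_saturated[OF aperiodic_recurrent[OF S(1-3) Y(1)]]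
    ergodic_meets[OF erg Y]
  show ?thesis
  proof eventually_elim
    case (elim x)
    show ?case
    proof (intro allI impI)
      fix Q :: "'a set" assume Q: "finite Q"
      obtain y where y: "y \<in> Y" "(x, y) \<in> R" using elim by blast
      let ?C = "((R \<inter> Y \<times> Y) `` {y}) // (S \<inter> Y \<times> Y)"
      have "infinite ?C" using elim(1) y by blast
      then have "\<not> ?C \<subseteq> (\<lambda>q. S `` {q} \<inter> Y) ` Q" using Q finite_surj by blast
      then obtain C where C: "C \<in> ?C" "C \<notin> (\<lambda>q. S `` {q} \<inter> Y) ` Q" by blast
      then obtain z where z: "z \<in> Y" "(y, z) \<in> R" "C = (S \<inter> Y \<times> Y) `` {z}"
        by (auto simp: quotient_def)
      have CS: "C = S `` {z} \<inter> Y" using z by auto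
      have "S `` {z} \<inter> Q = {}"
      proof (rule ccontr)
        assume "S `` {z} \<inter> Q \<noteq> {}"
        then obtain q where q: "(z, q) \<in> S" "q \<in> Q" by blast
        then have "S `` {z} = S `` {q}" using equiv_class_eq[OF S(2)] by blast
        then show False using C(2) q CS by blast
      qed
      moreover have "(x, z) \<in> R" using R_trans y z by blast
      ultimately show "\<exists>y\<in>Y. (x, y) \<in> R \<and> infinite (S `` {y} \<inter> Y) \<and> S `` {y} \<inter> Q = {}"
        using elim(2) z(1) by blast
    qed
  qed
qed

section \<open>Full group elements from their graphs\<close>

lemma full_group_of_graph:
  assumes Q: "Q \<in> sets N" "single_valued Q" "single_valued (Q\<inverse>)"
    "Domain Q = space M" "Range Q = space M"
  shows "\<exists>T\<in>full_group M R. Q = {(x, T x) | x. x \<in> space M}"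
proof -
  have QR: "Q \<subseteq> R" "Q \<in> sets (M \<Otimes>\<^sub>M M)" using Q(1) sets_N by auto
  have ex: "\<exists>T. \<forall>x\<in>space M. (x, T x) \<in> P"
    if "Domain P = space M" for P :: "('a \<times> 'a) set" using that by (intro bchoice) blast
  obtain T where T: "\<And>x. x \<in> space M \<Longrightarrow> (x, T x) \<in> Q" using ex[OF Q(4)] by blast
  obtain T' where T': "\<And>x. x \<in> space M \<Longrightarrow> (T' x, x) \<in> Q" using ex[of "Q\<inverse>"] Q(5) by auto
  have TQ: "(x, y) \<in> Q \<longleftrightarrow> x \<in> space M \<and> y = T x" for x y
    using T Q(4) single_valuedD[OF Q(2)] by blast
  have TQ': "(x, y) \<in> Q \<longleftrightarrow> y \<in> space M \<and> x = T' y" for x y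
    using T' Q(5) single_valuedD[OF Q(3)] by blast
  \<comment> \<open>A preimage is the domain of a Borel part of the graph. The claim is made for an
    arbitrary graph because it is applied to the inverse as well.\<close>
  have meas: "T \<in> M \<rightarrow>\<^sub>M M"
    if P: "P \<in> sets N" "\<And>x y. (x, y) \<in> P \<longleftrightarrow> x \<in> space M \<and> y = T x" for P T
  proof (rule measurableI)
    show "T x \<in> space M" if "x \<in> space M" for x
      using P that R_space[of x "T x"] sets_N by blast
    fix B assume "B \<in> sets M"
    then have "P \<inter> (space M \<times> B) \<in> sets N" using P(1) by (auto simp: sets_N)
    from sets_Domain[OF this] have "Domain (P \<inter> (space M \<times> B)) \<in> sets M" .
    moreover have "Domain (P \<inter> (space M \<times> B)) = T -` B \<inter> space M" using P(2) by auto
    ultimately show "T -` B \<inter> space M \<in> sets M" by simp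
  qed
  have mT: "T \<in> M \<rightarrow>\<^sub>M M" using meas[OF Q(1) TQ] .
  have mT': "T' \<in> M \<rightarrow>\<^sub>M M" by (rule meas[OF sets_N_converse[OF Q(1)]]) (auto simp: TQ')
  have inv1: "T' (T x) = x" if "x \<in> space M" for x using that T TQ' by metis
  have inv2: "T (T' x) = x" if "x \<in> space M" for x using that T' TQ by metis
  have sp: "T x \<in> space M" "T' x \<in> space M" if "x \<in> space M" for x
    using that mT mT' by (auto dest: measurable_space)
  have bij: "bij_betw T (space M) (space M)"
    by (rule bij_betwI[of _ _ _ T']) (use sp inv1 inv2 in auto)
  have "the_inv_into (space M) T x = T' x" if "x \<in> space M" for x
    using bij that by (intro the_inv_into_f_eq) (auto simp: bij_betw_def inv2 sp)
  then have inv: "the_inv_into (space M) T \<in> M \<rightarrow>\<^sub>M M"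
    using mT' measurable_cong[of M "the_inv_into (space M) T" T'] by blast
  have "distr M M T = M"
  proof (rule measure_eqI)
    fix B assume "B \<in> sets (distr M M T)"
    then have B: "B \<in> sets M" by simp
    \<comment> \<open>This part of the graph is a partial injection from the preimage of
      \<open>B\<close> onto \<open>B\<close>, so its two projections have equal measure.\<close>
    define A where "A = Q \<inter> (space M \<times> B)"
    have A: "A \<in> sets N" using Q(1) B by (auto simp: sets_N A_def)
    have "emeasure M (Domain A) = emeasure M (Range A)"
      using Q(2,3) by (intro emeasure_Domain_eq_Range[OF A]) (auto simp: A_def single_valued_def)
    moreover have "Domain A = T -` B \<inter> space M" by (auto simp: A_def TQ sp)
    moreover have "Range A = B"
      using sets.sets_into_space[OF B] sp inv2 by (auto simp: A_def TQ' Range_iff)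
    ultimately show "emeasure (distr M M T) B = emeasure M B" using mT B by (simp add: emeasure_distr)
  qed simp
  then have "T \<in> full_group M R" unfolding full_group_def using mT bij inv T QR(1) by auto
  moreover have "Q = {(x, T x) | x. x \<in> space M}" using TQ by auto
  ultimately show ?thesis by blast
qed

end

section \<open>The greedy matching\<close>

text \<open>A matching instruction: a point \<open>x\<close> sends \<open>g (src t) x\<close> to \<open>g (tgt t) x\<close>, provided that
  these two points have the signatures \<open>ssig t\<close> and \<open>tsig t\<close>.  Distinctness of the signatures
  makes all points obeying the same instructions at once a partial injection, and excluding the
  source signatures for \<open>K\<close>-neighbours prevents conflicts between points matched in the same
  step.\<close>

type_synonym instr = "nat \<times> nat \<times> nat \<times> nat"

abbreviation src :: "instr \<Rightarrow> nat" where "src t \<equiv> fst t"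
abbreviation tgt :: "instr \<Rightarrow> nat" where "tgt t \<equiv> fst (snd t)"
abbreviation ssig :: "instr \<Rightarrow> nat" where "ssig t \<equiv> fst (snd (snd t))"
abbreviation tsig :: "instr \<Rightarrow> nat" where "tsig t \<equiv> snd (snd (snd t))"

locale matching = pmp_relation M R g
  for M :: "'a measure" and R g +
  fixes F K S :: "('a \<times> 'a) set" and c :: "nat \<Rightarrow> 'a \<Rightarrow> nat"
  assumes F_sets: "F \<in> sets N" and F_equiv: "equiv (space M) F"
    and F_finite: "x \<in> space M \<Longrightarrow> finite (F `` {x})"
    and S_sets: "S \<in> sets N" and S_equiv: "equiv (space M) S"
    and K_sets: "K \<in> sets N" and K_sym: "sym K"
    and K_finite: "x \<in> space M \<Longrightarrow> finite (K `` {x})"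
    and c_measurable [measurable]: "\<And>n. c n \<in> M \<rightarrow>\<^sub>M count_space UNIV"
    and c_sep: "\<And>x y. x \<in> space M \<Longrightarrow> y \<in> space M \<Longrightarrow> x \<noteq> y \<Longrightarrow> \<exists>n0. \<forall>n\<ge>n0. c n x \<noteq> c n y"
begin

section \<open>One round of the matching\<close>

lemma FS_space: "(x, y) \<in> F \<Longrightarrow> x \<in> space M \<and> y \<in> space M" "(x, y) \<in> S \<Longrightarrow> x \<in> space M \<and> y \<in> space M"
  using F_equiv S_equiv by (auto simp: equiv_def)

lemma F_refl: "x \<in> space M \<Longrightarrow> (x, x) \<in> F"
  using F_equiv by (meson equivE refl_onD)

lemma F_sym: "(x, y) \<in> F \<Longrightarrow> (y, x) \<in> F"
  using F_equiv by (meson equivE symE)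

lemma S_sym: "(x, y) \<in> S \<Longrightarrow> (y, x) \<in> S"
  using S_equiv by (meson equivE symE)

lemma S_trans: "(x, y) \<in> S \<Longrightarrow> (y, z) \<in> S \<Longrightarrow> (x, z) \<in> S"
  using S_equiv by (meson equivE transE)

lemma sub_R: "F \<subseteq> R" "S \<subseteq> R" "K \<subseteq> R"
  using F_sets S_sets K_sets sets_N by auto

text \<open>These are the base points at which the whole list \<open>ts\<close> can be carried out
  when \<open>P\<close> is already matched. The sources exhaust one \<open>F\<close>-class. The last
  clause concerns \<open>K\<close>-neighbours outside this class: their signatures keep them from
  being sources in the same round, and if they were matched earlier, their images lie in other
  \<open>S\<close>-classes. Indices instead of points make measurability immediate.\<close>

definition cell :: "('a \<times> 'a) set \<Rightarrow> nat \<Rightarrow> instr list \<Rightarrow> 'a set" where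
  "cell P n ts = {x \<in> space M.
     (\<forall>t\<in>set ts. \<forall>t'\<in>set ts. t \<noteq> t' \<longrightarrow> ssig t \<noteq> ssig t' \<and> tsig t \<noteq> tsig t') \<and>
     (\<forall>t\<in>set ts. c n (g (src t) x) = ssig t \<and> c n (g (tgt t) x) = tsig t) \<and>
     (\<forall>t\<in>set ts. \<forall>i. (g (src t) x, g i x) \<notin> P \<and> (g i x, g (tgt t) x) \<notin> P) \<and>
     (\<forall>t\<in>set ts. \<forall>i. (g (src t) x, g i x) \<in> F \<longleftrightarrow> (\<exists>t'\<in>set ts. g i x = g (src t') x)) \<and>
     (\<forall>t\<in>set ts. \<forall>t'\<in>set ts. (g (tgt t) x, g (tgt t') x) \<in> S) \<and>
     (\<forall>t\<in>set ts. \<forall>i. (g (src t) x, g i x) \<in> K \<longrightarrow> (g (src t) x, g i x) \<notin> F \<longrightarrow>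
        (\<forall>t'\<in>set ts. c n (g i x) \<noteq> ssig t') \<and>
        (\<forall>j. (g i x, g j x) \<in> P \<longrightarrow> (g (tgt t) x, g j x) \<notin> S))}"

lemma cell_sets:
  assumes "P \<in> sets N" shows "cell P n ts \<in> sets M"
proof -
  have [measurable]: "P \<in> sets (M \<Otimes>\<^sub>M M)" "F \<in> sets (M \<Otimes>\<^sub>M M)" "K \<in> sets (M \<Otimes>\<^sub>M M)"
    "S \<in> sets (M \<Otimes>\<^sub>M M)"
    using assms F_sets K_sets S_sets by (auto simp: sets_N)
  show ?thesis unfolding cell_def by measurable
qed

lemma cellI:
  assumes "x \<in> space M" "P \<subseteq> R"
    and "\<And>t t'. t \<in> set ts \<Longrightarrow> t' \<in> set ts \<Longrightarrow> t \<noteq> t' \<Longrightarrow> ssig t \<noteq> ssig t' \<and> tsig t \<noteq> tsig t'"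
    and "\<And>t. t \<in> set ts \<Longrightarrow> c n (g (src t) x) = ssig t \<and> c n (g (tgt t) x) = tsig t"
    and "\<And>t. t \<in> set ts \<Longrightarrow> g (src t) x \<notin> Domain P \<and> g (tgt t) x \<notin> Range P"
    and "\<And>t. t \<in> set ts \<Longrightarrow> F `` {g (src t) x} = (\<lambda>t. g (src t) x) ` set ts"
    and "\<And>t t'. t \<in> set ts \<Longrightarrow> t' \<in> set ts \<Longrightarrow> (g (tgt t) x, g (tgt t') x) \<in> S"
    and "\<And>t t' z. t \<in> set ts \<Longrightarrow> t' \<in> set ts \<Longrightarrow> (g (src t) x, z) \<in> K \<Longrightarrow> (g (src t) x, z) \<notin> F \<Longrightarrow>
      c n z \<noteq> ssig t'"
    and "\<And>t z w. t \<in> set ts \<Longrightarrow> (g (src t) x, z) \<in> K \<Longrightarrow> (g (src t) x, z) \<notin> F \<Longrightarrow>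
      (z, w) \<in> P \<Longrightarrow> (g (tgt t) x, w) \<notin> S"
  shows "x \<in> cell P n ts"
proof -
  have "(g (src t) x, g i x) \<in> F \<longleftrightarrow> (\<exists>t'\<in>set ts. g i x = g (src t') x)" if "t \<in> set ts" for t i
    using assms(6)[OF that] by auto
  then show ?thesis
    unfolding cell_def using assms(1,3-5,7-9) by (auto simp: Domain_iff Range_iff)
qed

text \<open>As \<open>P\<close>, \<open>F\<close> and \<open>K\<close> lie in \<open>R\<close>,
  every point related to a source or a target is some \<open>g i x\<close>; hence the clauses on
  indices hold for points.\<close>

lemma
  assumes "x \<in> cell P n ts" "P \<subseteq> R"
  shows cell_space: "x \<in> space M"
    and cell_inj: "\<And>t t'. t \<in> set ts \<Longrightarrow> t' \<in> set ts \<Longrightarrow> ssig t = ssig t' \<or> tsig t = tsig t' \<Longrightarrow> t = t'"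
    and cell_sig: "\<And>t. t \<in> set ts \<Longrightarrow> c n (g (src t) x) = ssig t \<and> c n (g (tgt t) x) = tsig t"
    and cell_new: "\<And>t. t \<in> set ts \<Longrightarrow> g (src t) x \<notin> Domain P \<and> g (tgt t) x \<notin> Range P"
    and cell_F: "\<And>t. t \<in> set ts \<Longrightarrow> F `` {g (src t) x} = (\<lambda>t. g (src t) x) ` set ts"
    and cell_S: "\<And>t t'. t \<in> set ts \<Longrightarrow> t' \<in> set ts \<Longrightarrow> (g (tgt t) x, g (tgt t') x) \<in> S"
    and cell_K_sig: "\<And>t t' z. t \<in> set ts \<Longrightarrow> t' \<in> set ts \<Longrightarrow> (g (src t) x, z) \<in> K \<Longrightarrow>
      (g (src t) x, z) \<notin> F \<Longrightarrow> c n z \<noteq> ssig t'"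
    and cell_K: "\<And>t z w. t \<in> set ts \<Longrightarrow> (g (src t) x, z) \<in> K \<Longrightarrow> (g (src t) x, z) \<notin> F \<Longrightarrow>
      (z, w) \<in> P \<Longrightarrow> (g (tgt t) x, w) \<notin> S"
proof -
  from assms(1) have sp: "x \<in> space M"
    and inj: "\<forall>t\<in>set ts. \<forall>t'\<in>set ts. t \<noteq> t' \<longrightarrow> ssig t \<noteq> ssig t' \<and> tsig t \<noteq> tsig t'"
    and sig: "\<forall>t\<in>set ts. c n (g (src t) x) = ssig t \<and> c n (g (tgt t) x) = tsig t"
    and new: "\<forall>t\<in>set ts. \<forall>i. (g (src t) x, g i x) \<notin> P \<and> (g i x, g (tgt t) x) \<notin> P"
    and F: "\<forall>t\<in>set ts. \<forall>i. (g (src t) x, g i x) \<in> F \<longleftrightarrow> (\<exists>t'\<in>set ts. g i x = g (src t') x)"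
    and S: "\<forall>t\<in>set ts. \<forall>t'\<in>set ts. (g (tgt t) x, g (tgt t') x) \<in> S"
    and K: "\<forall>t\<in>set ts. \<forall>i. (g (src t) x, g i x) \<in> K \<longrightarrow> (g (src t) x, g i x) \<notin> F \<longrightarrow>
        (\<forall>t'\<in>set ts. c n (g i x) \<noteq> ssig t') \<and>
        (\<forall>j. (g i x, g j x) \<in> P \<longrightarrow> (g (tgt t) x, g j x) \<notin> S)"
    unfolding cell_def mem_Collect_eq by - (elim conjE; assumption)+
  show "x \<in> space M" by (rule sp)
  have ex: "\<exists>i. y = g i x" if "(g k x, y) \<in> R" for k y
    using that by (auto elim: R_obtain_g[OF sp])
  have ex': "\<exists>i. y = g i x" if "(y, g k x) \<in> R" for k y
    using ex[OF R_sym[OF that]] .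
  show "t = t'" if "t \<in> set ts" "t' \<in> set ts" "ssig t = ssig t' \<or> tsig t = tsig t'" for t t'
    using inj that by blast
  show "c n (g (src t) x) = ssig t \<and> c n (g (tgt t) x) = tsig t" if "t \<in> set ts" for t
    using sig that by blast
  show "g (src t) x \<notin> Domain P \<and> g (tgt t) x \<notin> Range P" if t: "t \<in> set ts" for t
  proof (intro conjI notI)
    assume "g (src t) x \<in> Domain P"
    then obtain y where y: "(g (src t) x, y) \<in> P" by blast
    then obtain i where "y = g i x" using ex assms(2) by blast
    then show False using y new[rule_format, OF t] by blast
  next
    assume "g (tgt t) x \<in> Range P"
    then obtain y where y: "(y, g (tgt t) x) \<in> P" by blast
    then obtain i where "y = g i x" using ex' assms(2) by blast
    then show False using y new[rule_format, OF t] by blast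
  qed
  show "F `` {g (src t) x} = (\<lambda>t. g (src t) x) ` set ts" if t: "t \<in> set ts" for t
  proof (intro equalityI subsetI)
    fix y assume "y \<in> F `` {g (src t) x}"
    then have y: "(g (src t) x, y) \<in> F" by blast
    then obtain i where i: "y = g i x" using ex sub_R by blast
    show "y \<in> (\<lambda>t. g (src t) x) ` set ts" using F[rule_format, OF t, of i] y i by simp blast
  next
    fix y assume "y \<in> (\<lambda>t. g (src t) x) ` set ts"
    then obtain t' where t': "t' \<in> set ts" "y = g (src t') x" by blast
    then show "y \<in> F `` {g (src t) x}" using F[rule_format, OF t, of "src t'"] by blast
  qed
  show "(g (tgt t) x, g (tgt t') x) \<in> S" if "t \<in> set ts" "t' \<in> set ts" for t t'
    using S that by blast
  show "c n z \<noteq> ssig t'"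
    if h: "t \<in> set ts" "t' \<in> set ts" "(g (src t) x, z) \<in> K" "(g (src t) x, z) \<notin> F" for t t' z
  proof -
    obtain i where i: "z = g i x" using ex h(3) sub_R by blast
    show ?thesis using K[rule_format, OF h(1)] h(2-4) unfolding i by blast
  qed
  show "(g (tgt t) x, w) \<notin> S"
    if h: "t \<in> set ts" "(g (src t) x, z) \<in> K" "(g (src t) x, z) \<notin> F" "(z, w) \<in> P" for t z w
  proof -
    obtain i where i: "z = g i x" using ex h(2) sub_R by blast
    obtain j where j: "w = g j x" using ex[of i w] h(4) assms(2) i by blast
    show ?thesis using K[rule_format, OF h(1)] h(2-4) unfolding i j by blast
  qed
qed

definition match :: "('a \<times> 'a) set \<Rightarrow> nat \<Rightarrow> instr list \<Rightarrow> ('a \<times> 'a) set" where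
  "match P n ts = {(g (src t) x, g (tgt t) x) | t x. t \<in> set ts \<and> x \<in> cell P n ts}"

text \<open>Parametrized by its source, the contribution of one instruction is the graph of the
  measurable map \<open>g j \<circ> g i'\<close>, with \<open>g i'\<close> inverse to
  \<open>g i\<close>, over a Borel set.\<close>

lemma match_sets:
  assumes "P \<in> sets N" shows "match P n ts \<in> sets N"
proof -
  have C [measurable]: "cell P n ts \<in> sets M" by (rule cell_sets[OF assms])
  have piece: "(\<lambda>x. (g i x, g j x)) ` cell P n ts \<in> sets N" for i j
  proof -
    obtain i' where i': "\<And>x. x \<in> space M \<Longrightarrow> g i' (g i x) = x" "\<And>x. x \<in> space M \<Longrightarrow> g i (g i' x) = x"
      by (rule g_inverse_both[of i]) blast
    have "{x \<in> space M. g i' x \<in> cell P n ts} \<in> sets M" by measurable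
    moreover have "{(x, (g j \<circ> g i') x) | x. x \<in> space M} \<in> sets (M \<Otimes>\<^sub>M M)"
      by (intro graph_measurable(2)[OF std _ measurable_ident]) measurable
    ultimately have "{(x, (g j \<circ> g i') x) | x. x \<in> space M} \<inter>
        ({x \<in> space M. g i' x \<in> cell P n ts} \<times> space M) \<in> sets (M \<Otimes>\<^sub>M M)"
      by (intro sets.Int pair_measureI) auto
    moreover have "{(x, (g j \<circ> g i') x) | x. x \<in> space M} \<inter>
        ({x \<in> space M. g i' x \<in> cell P n ts} \<times> space M) = (\<lambda>x. (g i x, g j x)) ` cell P n ts"
    proof (intro equalityI subsetI)
      fix p assume "p \<in> {(x, (g j \<circ> g i') x) | x. x \<in> space M} \<inter>
        ({x \<in> space M. g i' x \<in> cell P n ts} \<times> space M)"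
      then obtain u where "u \<in> space M" "g i' u \<in> cell P n ts" "p = (u, g j (g i' u))" by auto
      then have "g i' u \<in> cell P n ts" "p = (g i (g i' u), g j (g i' u))" using i' by auto
      then show "p \<in> (\<lambda>x. (g i x, g j x)) ` cell P n ts" by blast
    next
      fix p assume "p \<in> (\<lambda>x. (g i x, g j x)) ` cell P n ts"
      then obtain x where "x \<in> space M" "x \<in> cell P n ts" "p = (g i x, g j x)"
        using sets.sets_into_space[OF C] by blast
      then show "p \<in> {(x, (g j \<circ> g i') x) | x. x \<in> space M} \<inter>
        ({x \<in> space M. g i' x \<in> cell P n ts} \<times> space M)"
        using i' g_space by auto
    qed
    moreover have "(\<lambda>x. (g i x, g j x)) ` cell P n ts \<subseteq> R"
      using sets.sets_into_space[OF C] R_gg by auto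
    ultimately show ?thesis by (simp add: sets_N)
  qed
  have "match P n ts = (\<Union>t\<in>set ts. (\<lambda>x. (g (src t) x, g (tgt t) x)) ` cell P n ts)"
    unfolding match_def by blast
  then show ?thesis using piece by auto
qed

text \<open>The invariant of the matching. The clause on \<open>F\<close> also makes the domain a
  union of \<open>F\<close>-classes; the clause on \<open>K\<close> is its converse, demanded only
  within the window \<open>K\<close>.\<close>

definition good :: "('a \<times> 'a) set \<Rightarrow> bool" where
  "good P \<longleftrightarrow> P \<in> sets N \<and> single_valued P \<and> single_valued (P\<inverse>) \<and>
     (\<forall>x x' y. (x, x') \<in> P \<longrightarrow> (x, y) \<in> F \<longrightarrow> (\<exists>y'. (y, y') \<in> P \<and> (x', y') \<in> S)) \<and>
     (\<forall>x x' y y'. (x, x') \<in> P \<longrightarrow> (y, y') \<in> P \<longrightarrow> (x, y) \<in> K \<longrightarrow> (x, y) \<notin> F \<longrightarrow> (x', y') \<notin> S)"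

text \<open>New pairs share neither sources nor targets with \<open>P\<close>, so injectivity has to
  be checked among the new pairs only. In the clause on \<open>K\<close>, symmetry allows the new
  pair to be put first.\<close>

lemma good_step:
  assumes "good P" shows "good (P \<union> match P n ts)"
proof -
  have P: "P \<in> sets N" "single_valued P" "single_valued (P\<inverse>)"
    and PF: "\<And>x x' y. (x, x') \<in> P \<Longrightarrow> (x, y) \<in> F \<Longrightarrow> \<exists>y'. (y, y') \<in> P \<and> (x', y') \<in> S"
    and PK: "\<And>x x' y y'. (x, x') \<in> P \<Longrightarrow> (y, y') \<in> P \<Longrightarrow> (x, y) \<in> K \<Longrightarrow> (x, y) \<notin> F \<Longrightarrow> (x', y') \<notin> S"
    using assms unfolding good_def by blast+
  have PR: "P \<subseteq> R" using P(1) sets_N by blast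
  \<comment> \<open>The signature of a source determines the instruction, and injectivity of
    \<open>g (src t)\<close> then determines the base point.\<close>
  have src_inj: "t = t' \<and> x = x'"
    if "t \<in> set ts" "t' \<in> set ts" "x \<in> cell P n ts" "x' \<in> cell P n ts" "g (src t) x = g (src t') x'"
    for t t' x x'
  proof -
    have "ssig t = ssig t'" using cell_sig[OF that(3) PR that(1)] cell_sig[OF that(4) PR that(2)] that(5) by simp
    then have "t = t'" using cell_inj[OF that(3) PR] that by blast
    then show ?thesis using g_inj cell_space[OF _ PR] that by metis
  qed
  have tgt_inj: "t = t' \<and> x = x'"
    if "t \<in> set ts" "t' \<in> set ts" "x \<in> cell P n ts" "x' \<in> cell P n ts" "g (tgt t) x = g (tgt t') x'"
    for t t' x x'
  proof -
    have "tsig t = tsig t'" using cell_sig[OF that(3) PR that(1)] cell_sig[OF that(4) PR that(2)] that(5) by simp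
    then have "t = t'" using cell_inj[OF that(3) PR] that by blast
    then show ?thesis using g_inj cell_space[OF _ PR] that by metis
  qed
  have mD: "\<exists>t x. t \<in> set ts \<and> x \<in> cell P n ts \<and> u = g (src t) x \<and> w = g (tgt t) x"
    if "(u, w) \<in> match P n ts" for u w
    using that unfolding match_def by blast
  have mI: "(g (src t) x, g (tgt t) x) \<in> match P n ts" if "t \<in> set ts" "x \<in> cell P n ts" for t x
    using that unfolding match_def by blast
  have new: "u \<notin> Domain P \<and> w \<notin> Range P" if "(u, w) \<in> match P n ts" for u w
    using mD[OF that] cell_new[OF _ PR] by blast
  have KS: "(u', z') \<notin> S"
    if h: "(u, u') \<in> match P n ts" "(z, z') \<in> P \<union> match P n ts" "(u, z) \<in> K" "(u, z) \<notin> F" for u u' z z'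
  proof -
    obtain t x where t: "t \<in> set ts" "x \<in> cell P n ts" "u = g (src t) x" "u' = g (tgt t) x"
      using mD[OF h(1)] by blast
    from h(2) show ?thesis
    proof
      assume "(z, z') \<in> P"
      then show ?thesis using cell_K[OF t(2) PR t(1)] h(3,4) t(3,4) by blast
    next
      \<comment> \<open>This case is void: as a source of the round, \<open>z\<close> would carry a
        source signature, which is denied to \<open>K\<close>-neighbours outside the
        \<open>F\<close>-class.\<close>
      assume "(z, z') \<in> match P n ts"
      then obtain t' x' where t': "t' \<in> set ts" "x' \<in> cell P n ts" "z = g (src t') x'"
        using mD by blast
      have "c n z = ssig t'" using cell_sig[OF t'(2) PR t'(1)] t'(3) by simp
      then show ?thesis using cell_K_sig[OF t(2) PR t(1) t'(1)] h(3,4) t(3) by blast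
    qed
  qed
  show ?thesis unfolding good_def
  proof (intro conjI allI impI)
    show "P \<union> match P n ts \<in> sets N" using P(1) match_sets[OF P(1)] by blast
    show "single_valued (P \<union> match P n ts)"
    proof (rule single_valuedI)
      fix x y z assume yz: "(x, y) \<in> P \<union> match P n ts" "(x, z) \<in> P \<union> match P n ts"
      show "y = z"
      proof (cases "x \<in> Domain P")
        case True
        then show ?thesis using yz new P(2) unfolding single_valued_def by blast
      next
        case False
        then have "(x, y) \<in> match P n ts" "(x, z) \<in> match P n ts" using yz by blast+
        then show ?thesis using mD src_inj by metis
      qed
    qed
    show "single_valued ((P \<union> match P n ts)\<inverse>)"
    proof (rule single_valuedI)
      fix x y z assume "(x, y) \<in> (P \<union> match P n ts)\<inverse>" "(x, z) \<in> (P \<union> match P n ts)\<inverse>"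
      then have yz: "(y, x) \<in> P \<union> match P n ts" "(z, x) \<in> P \<union> match P n ts" by auto
      show "y = z"
      proof (cases "x \<in> Range P")
        case True
        then show ?thesis using yz new P(3) unfolding single_valued_def by blast
      next
        case False
        then have "(y, x) \<in> match P n ts" "(z, x) \<in> match P n ts" using yz by blast+
        then show ?thesis using mD tgt_inj by metis
      qed
    qed
  next
    fix u u' z assume u: "(u, u') \<in> P \<union> match P n ts" and uz: "(u, z) \<in> F"
    from u show "\<exists>z'. (z, z') \<in> P \<union> match P n ts \<and> (u', z') \<in> S"
    proof
      assume "(u, u') \<in> P"
      then show ?thesis using PF[OF _ uz] by blast
    next
      assume "(u, u') \<in> match P n ts"
      then obtain t x where t: "t \<in> set ts" "x \<in> cell P n ts" "u = g (src t) x" "u' = g (tgt t) x"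
        using mD by blast
      have "z \<in> F `` {g (src t) x}" using uz t(3) by simp
      then obtain t' where t': "t' \<in> set ts" "z = g (src t') x"
        unfolding cell_F[OF t(2) PR t(1)] by blast
      show ?thesis using mI[OF t'(1) t(2)] cell_S[OF t(2) PR t(1) t'(1)] t'(2) t(4) by blast
    qed
  next
    fix u u' z z'
    assume u: "(u, u') \<in> P \<union> match P n ts" and z: "(z, z') \<in> P \<union> match P n ts"
      and K: "(u, z) \<in> K" and F: "(u, z) \<notin> F"
    have K': "(z, u) \<in> K" using K K_sym by (meson symE)
    have F': "(z, u) \<notin> F" using F F_sym by blast
    consider "(u, u') \<in> match P n ts" | "(z, z') \<in> match P n ts" | "(u, u') \<in> P" "(z, z') \<in> P"
      using u z by blast
    then show "(u', z') \<notin> S"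
    proof cases
      case 1 then show ?thesis using KS z K F by blast
    next
      case 2 then show ?thesis using KS[OF _ u K' F'] S_sym by blast
    next
      case 3 then show ?thesis using PK K F by blast
    qed
  qed
qed

section \<open>Iteration over all instruction lists, and its limit\<close>

primrec stage :: "nat \<Rightarrow> ('a \<times> 'a) set" where
  "stage 0 = {}"
| "stage (Suc k) = (case from_nat k of (n, ts) \<Rightarrow> stage k \<union> match (stage k) n ts)"

lemma good_stage: "good (stage k)"
  by (induction k) (auto simp: good_step split: prod.split, simp add: good_def)

lemma incseq_stage: "incseq stage"
  by (rule incseq_SucI) (auto split: prod.split)

definition limit :: "('a \<times> 'a) set" where
  "limit = (\<Union>k. stage k)"

lemma limit_common_stage:
  assumes "p \<in> limit" "q \<in> limit"
  obtains k where "p \<in> stage k" "q \<in> stage k"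
proof -
  obtain i j where "p \<in> stage i" "q \<in> stage j" using assms unfolding limit_def by blast
  then have "p \<in> stage (max i j)" "q \<in> stage (max i j)"
    using incseq_stage unfolding incseq_def by (meson max.cobounded1 max.cobounded2 subsetD)+
  then show thesis by (rule that)
qed

text \<open>Each clause involves at most two pairs of the matching, and these already occur at a
  common stage.\<close>

lemma good_limit: "good limit"
proof -
  have g: "stage k \<in> sets N" "single_valued (stage k)" "single_valued ((stage k)\<inverse>)"
    "\<And>x x' y. (x, x') \<in> stage k \<Longrightarrow> (x, y) \<in> F \<Longrightarrow> \<exists>y'. (y, y') \<in> stage k \<and> (x', y') \<in> S"
    "\<And>x x' y y'. (x, x') \<in> stage k \<Longrightarrow> (y, y') \<in> stage k \<Longrightarrow> (x, y) \<in> K \<Longrightarrow> (x, y) \<notin> F \<Longrightarrow> (x', y') \<notin> S"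
    for k
    using good_stage[of k] unfolding good_def by blast+
  show ?thesis unfolding good_def
  proof (intro conjI allI impI)
    show "limit \<in> sets N" unfolding limit_def using g(1) by auto
    show "single_valued limit"
      using g(2) by (intro single_valuedI) (metis limit_common_stage single_valuedD)
    show "single_valued (limit\<inverse>)"
      using g(3) by (intro single_valuedI) (metis converse_iff limit_common_stage single_valuedD)
  next
    fix x x' y assume h: "(x, x') \<in> limit" "(x, y) \<in> F"
    obtain k where k: "(x, x') \<in> stage k" using h(1) unfolding limit_def by blast
    from g(4)[OF k h(2)] obtain y' where "(y, y') \<in> stage k" "(x', y') \<in> S" by blast
    then show "\<exists>y'. (y, y') \<in> limit \<and> (x', y') \<in> S" unfolding limit_def by blast
  next
    fix x x' y y' assume h: "(x, x') \<in> limit" "(y, y') \<in> limit" "(x, y) \<in> K" "(x, y) \<notin> F"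
    obtain k where "(x, x') \<in> stage k" "(y, y') \<in> stage k"
      using h(1,2) by (rule limit_common_stage)
    then show "(x', y') \<notin> S" using g(5) h(3,4) by blast
  qed
qed

lemma
  shows limit_sets: "limit \<in> sets N"
    and limit_single_valued: "single_valued limit" "single_valued (limit\<inverse>)"
    and limit_F: "\<And>x x' y. (x, x') \<in> limit \<Longrightarrow> (x, y) \<in> F \<Longrightarrow> \<exists>y'. (y, y') \<in> limit \<and> (x', y') \<in> S"
    and limit_K: "\<And>x x' y y'. (x, x') \<in> limit \<Longrightarrow> (y, y') \<in> limit \<Longrightarrow> (x, y) \<in> K \<Longrightarrow> (x, y) \<notin> F \<Longrightarrow>
      (x', y') \<notin> S"
  using good_limit unfolding good_def by blast+

text \<open>An unmatched point \<open>x\<close> would have been matched: the \<open>S\<close>-classes to be avoided by its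
  \<open>F\<close>-class are finitely many, so some other class offers enough unused points, and the
  resulting list of instructions occurs as some \<open>from_nat k\<close>.\<close>

lemma limit_maximal:
  assumes x: "x \<in> space M"
    and many: "\<And>Q. finite Q \<Longrightarrow> \<exists>y\<in>space M - Range limit. (x, y) \<in> R \<and>
      infinite (S `` {y} \<inter> (space M - Range limit)) \<and> S `` {y} \<inter> Q = {}"
  shows "x \<in> Domain limit"
proof (rule ccontr)
  assume nx: "x \<notin> Domain limit"
  let ?Z = "\<Union>(((\<lambda>u. K `` {u}) ` (F `` {x})))"
  have Fx: "finite (F `` {x})" "F `` {x} \<subseteq> space M" "x \<in> F `` {x}"
    using F_finite[OF x] FS_space F_refl[OF x] by auto
  have Z: "finite ?Z" "?Z \<subseteq> space M"
  proof -
    show "finite ?Z" using Fx K_finite by blast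
    show "?Z \<subseteq> space M" using sub_R R_space by blast
  qed
  \<comment> \<open>These are the images already given to \<open>K\<close>-neighbours of the
    \<open>F\<close>-class of \<open>x\<close>; the \<open>S\<close>-class to be chosen has to avoid
    them.\<close>
  have "finite (limit `` ?Z)"
  proof -
    have "limit `` {z} \<subseteq> {SOME w. (z, w) \<in> limit}" for z
      using limit_single_valued(1) unfolding single_valued_def by (auto intro: someI2)
    then have "finite (limit `` {z})" for z using finite_subset by blast
    moreover have "limit `` ?Z = (\<Union>z\<in>?Z. limit `` {z})" by blast
    ultimately show ?thesis using finite_UN_I[OF Z(1)] by metis
  qed
  from many[OF this] obtain y where y: "y \<in> space M" "(x, y) \<in> R"
    "infinite (S `` {y} \<inter> (space M - Range limit))" "S `` {y} \<inter> limit `` ?Z = {}"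
    by blast
  obtain Y where Y: "finite Y" "card Y = card (F `` {x})" "Y \<subseteq> S `` {y} \<inter> (space M - Range limit)"
    using infinite_arbitrarily_large[OF y(3)] by blast
  obtain b where b: "bij_betw b (F `` {x}) Y"
    using finite_same_card_bij[OF Fx(1) Y(1)] Y(2) by metis
  have bY: "b u \<in> Y" if "u \<in> F `` {x}" for u using bij_betwE[OF b] that by blast
  \<comment> \<open>The signature level is chosen after the targets, so that it separates the
    sources from one another and from their \<open>K\<close>-neighbours, and the targets from one
    another.\<close>
  have "\<forall>\<^sub>F n in sequentially. inj_on (c n) (F `` {x} \<union> ?Z) \<and> inj_on (c n) Y"
    using Fx Z Y by (intro eventually_conj finite_signature[OF c_sep]) auto
  then obtain n where n: "inj_on (c n) (F `` {x} \<union> ?Z)" "inj_on (c n) Y"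
    by (auto simp: eventually_sequentially)
  \<comment> \<open>A point of the class may occur several times in the enumeration; any index will
    do.\<close>
  define idx where "idx u = (SOME i. u = g i x)" for u
  have idx: "g (idx u) x = u" if u: "(x, u) \<in> R" for u
  proof -
    obtain i where "u = g i x" using u by (rule R_obtain)
    then show ?thesis unfolding idx_def by (metis (mono_tags) someI)
  qed
  define ins where "ins u = (idx u, idx (b u), c n u, c n (b u))" for u
  have src: "g (src (ins u)) x = u" if "u \<in> F `` {x}" for u
    using that idx sub_R by (auto simp: ins_def)
  have tgt: "g (tgt (ins u)) x = b u" if "u \<in> F `` {x}" for u
  proof -
    have "(x, b u) \<in> R" using bY[OF that] Y(3) y(2) sub_R R_trans by blast
    then show ?thesis using idx by (simp add: ins_def)
  qed
  obtain us where us: "set us = F `` {x}" using finite_list[OF Fx(1)] by blast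
  define ts where "ts = map ins us"
  have ts: "set ts = ins ` (F `` {x})" by (simp add: ts_def us)
  have Fu: "F `` {u} = F `` {x}" if "u \<in> F `` {x}" for u
    using equiv_class_eq[OF F_equiv] that by blast
  \<comment> \<open>\<open>P\<close> enters \<open>cell\<close> only through exclusions. Conditions
    verified against \<open>limit\<close> therefore hold at stage \<open>k\<close> too, and a single
    visit to each list suffices.\<close>
  define k where "k = to_nat (n, ts)"
  have k: "from_nat k = (n, ts)" by (simp add: k_def)
  have sub: "stage k \<subseteq> limit" unfolding limit_def by blast
  have LR: "limit \<subseteq> R" using limit_sets sets_N by blast
  have "x \<in> cell (stage k) n ts"
  proof (rule cellI[OF x])
    show "stage k \<subseteq> R" using sub LR by blast
    fix t assume "t \<in> set ts"
    then obtain u where u: "u \<in> F `` {x}" "t = ins u" using ts by blast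
    show "c n (g (src t) x) = ssig t \<and> c n (g (tgt t) x) = tsig t"
      using u src tgt by (simp add: ins_def)
    show "g (src t) x \<notin> Domain (stage k) \<and> g (tgt t) x \<notin> Range (stage k)"
    proof
      \<comment> \<open>The domain of \<open>limit\<close> is a union of \<open>F\<close>-classes,
        so together with \<open>x\<close> its whole class is unmatched.\<close>
      have "u \<notin> Domain limit" using nx limit_F F_sym u(1) by blast
      then show "g (src t) x \<notin> Domain (stage k)" using sub src u by auto
      have "b u \<notin> Range limit" using bY[OF u(1)] Y(3) by blast
      then show "g (tgt t) x \<notin> Range (stage k)" using sub tgt u by auto
    qed
    show "F `` {g (src t) x} = (\<lambda>t. g (src t) x) ` set ts"
    proof -
      have "(\<lambda>t. g (src t) x) ` set ts = F `` {x}" unfolding ts image_image using src by simp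
      then show ?thesis using Fu u src by simp
    qed
    show "(g (tgt t) x, w) \<notin> S"
      if "(g (src t) x, z) \<in> K" "(g (src t) x, z) \<notin> F" "(z, w) \<in> stage k" for z w
    proof
      assume "(g (tgt t) x, w) \<in> S"
      then have "(b u, w) \<in> S" using tgt u by simp
      moreover have "(y, b u) \<in> S" using bY[OF u(1)] Y(3) by blast
      ultimately have "w \<in> S `` {y}" using S_trans by blast
      moreover have "z \<in> ?Z" using that(1) src u by auto
      ultimately show False using y(4) that(3) sub by blast
    qed
    fix t' assume "t' \<in> set ts"
    then obtain u' where u': "u' \<in> F `` {x}" "t' = ins u'" using ts by blast
    show "ssig t \<noteq> ssig t' \<and> tsig t \<noteq> tsig t'" if "t \<noteq> t'"
    proof -
      have "u \<noteq> u'" using that u u' by blast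
      moreover from this have "b u \<noteq> b u'"
        using b u(1) u'(1) unfolding bij_betw_def inj_on_def by blast
      ultimately show ?thesis
        using n bY u u' unfolding inj_on_def by (auto simp: ins_def)
    qed
    show "(g (tgt t) x, g (tgt t') x) \<in> S"
      using bY[OF u(1)] bY[OF u'(1)] Y(3) S_sym S_trans tgt u u' by (metis IntD1 Image_singleton_iff subsetD)
    show "c n z \<noteq> ssig t'" if "(g (src t) x, z) \<in> K" "(g (src t) x, z) \<notin> F" for z
    proof
      assume "c n z = ssig t'"
      then have "c n z = c n u'" using u' by (simp add: ins_def)
      moreover have "z \<in> ?Z" using that(1) src u by auto
      ultimately have "z = u'" using n(1) u'(1) unfolding inj_on_def by blast
      then show False using that(2) u' u src Fu by auto
    qed
  qed
  then have "(g (src (ins x)) x, g (tgt (ins x)) x) \<in> match (stage k) n ts"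
    unfolding match_def ts using Fx(3) by blast
  then have "(g (src (ins x)) x, g (tgt (ins x)) x) \<in> stage (Suc k)" by (simp add: k)
  then have "(x, g (tgt (ins x)) x) \<in> limit" unfolding limit_def src[OF Fx(3)] by blast
  then show False using nx by blast
qed

end

section \<open>Approximation of hyperfinite subrelations\<close>

context pmp_relation
begin

section \<open>Images under the full group; finite and locally finite approximants\<close>

lemma borel_subrels_iff: "S \<in> borel_subrels M R \<longleftrightarrow> S \<in> sets N \<and> equiv (space M) S"
  by (auto simp: borel_subrels_def sets_N)

lemma full_group_image_subrel:
  assumes T: "T \<in> full_group M R" and S: "S \<in> borel_subrels M R"
  shows "map_prod T T ` S \<inter> R \<in> borel_subrels M R"
proof -
  define U where "U = the_inv_into (space M) T"
  have bij: "bij_betw T (space M) (space M)" and [measurable]: "U \<in> M \<rightarrow>\<^sub>M M"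
    using T by (auto simp: full_group_def U_def)
  have S': "S \<in> sets (M \<Otimes>\<^sub>M M)" "equiv (space M) S" using S by (auto simp: borel_subrels_def)
  have S_space: "x \<in> space M \<and> y \<in> space M" if "(x, y) \<in> S" for x y
    using that S'(2) by (auto simp: equiv_def)
  have U: "T (U x) = x" "U x \<in> space M" if "x \<in> space M" for x
    using that bij f_the_inv_into_f_bij_betw[OF bij] the_inv_into_into[of T "space M" x "space M"]
    by (auto simp: U_def bij_betw_def)
  have UT: "U (T x) = x" "T x \<in> space M" if "x \<in> space M" for x
    using that bij by (auto simp: U_def bij_betw_def the_inv_into_f_f)
  have iff: "(x, y) \<in> map_prod T T ` S \<longleftrightarrow> x \<in> space M \<and> y \<in> space M \<and> (U x, U y) \<in> S" for x y
  proof
    assume "x \<in> space M \<and> y \<in> space M \<and> (U x, U y) \<in> S"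
    then have "(U x, U y) \<in> S" "(x, y) = map_prod T T (U x, U y)" using U by auto
    then show "(x, y) \<in> map_prod T T ` S" by blast
  qed (use S_space UT in auto)
  have "map_prod T T ` S = (\<lambda>p. (U (fst p), U (snd p))) -` S \<inter> space (M \<Otimes>\<^sub>M M)"
    unfolding set_eq_iff split_paired_All iff by (auto simp: space_pair_measure)
  also have "\<dots> \<in> sets (M \<Otimes>\<^sub>M M)" by (rule measurable_sets[OF _ S'(1)]) measurable
  finally have "map_prod T T ` S \<inter> R \<in> sets (M \<Otimes>\<^sub>M M)" by auto
  moreover have "equiv (space M) (map_prod T T ` S \<inter> R)"
  proof (rule equivI)
    show "map_prod T T ` S \<inter> R \<subseteq> space M \<times> space M" using R_space by blast
    show "refl_on (space M) (map_prod T T ` S \<inter> R)"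
    proof (rule refl_onI)
      fix x assume "x \<in> space M"
      moreover from this have "(U x, U x) \<in> S" using U S'(2) by (meson equivE refl_onD)
      ultimately show "(x, x) \<in> map_prod T T ` S \<inter> R" using R_refl iff by blast
    qed
    show "sym (map_prod T T ` S \<inter> R)"
    proof (rule symI)
      fix x y assume "(x, y) \<in> map_prod T T ` S \<inter> R"
      then show "(y, x) \<in> map_prod T T ` S \<inter> R"
        using S'(2) R_sym iff by (meson IntI IntE equivE symE)
    qed
    show "trans (map_prod T T ` S \<inter> R)"
    proof (rule transI)
      fix x y z assume "(x, y) \<in> map_prod T T ` S \<inter> R" "(y, z) \<in> map_prod T T ` S \<inter> R"
      then show "(x, z) \<in> map_prod T T ` S \<inter> R"
        using S'(2) R_trans iff by (meson IntI IntE equivE transE)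
    qed
  qed
  ultimately show ?thesis by (simp add: borel_subrels_def)
qed

lemma hyperfinite_finite_approx:
  assumes m: "finite_measure m" "equivalent_measures m N"
    and H: "H \<in> borel_subrels M R" "hyperfinite_rel M H" and e: "(e :: real) > 0"
  shows "\<exists>F\<in>borel_subrels M R. F \<subseteq> H \<and> (\<forall>x. finite (F `` {x})) \<and> measure m (H - F) < e"
proof -
  interpret m: finite_measure m by (rule m(1))
  have sm: "sets m = sets N" using m(2) by (simp add: equivalent_measures_def)
  have HN: "H \<in> sets N" "equiv (space M) H" using H(1) by (auto simp: borel_subrels_iff)
  obtain X0 F where X0: "X0 \<in> sets M" "space M - X0 \<in> null_sets M" and F: "incseq F"
    "\<And>n. F n \<in> sets (M \<Otimes>\<^sub>M M)" "\<And>n. equiv X0 (F n)" "\<And>n x. x \<in> X0 \<Longrightarrow> finite (F n `` {x})"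
    and HF: "H \<inter> (X0 \<times> X0) = (\<Union>n. F n)"
    using H(2) unfolding hyperfinite_rel_def by blast
  have X0s: "X0 \<subseteq> space M" using sets.sets_into_space[OF X0(1)] .
  have FX: "F n \<subseteq> X0 \<times> X0" for n using F(3) by (auto simp: equiv_def)
  \<comment> \<open>\<open>F n\<close> is an equivalence relation on \<open>X0\<close> only;
    singleton classes elsewhere extend it to the whole space.\<close>
  define E where "E n = F n \<union> Id_on (space M) \<inter> ((space M - X0) \<times> space M)" for n
  have E_iff: "(x, y) \<in> E n \<longleftrightarrow> (x, y) \<in> F n \<or> x = y \<and> x \<in> space M - X0" for x y n
    by (auto simp: E_def)
  have E_eq: "equiv (space M) (E n)" for n
  proof (rule equivI)
    show "E n \<subseteq> space M \<times> space M" using FX X0s by (auto simp: E_def)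
    show "refl_on (space M) (E n)"
      using F(3)[of n] by (intro refl_onI) (auto simp: E_iff dest: equivE refl_onD elim: equivE)
    show "sym (E n)"
      using F(3)[of n] by (intro symI) (auto simp: E_iff elim: equivE dest: symD)
    show "trans (E n)"
      using F(3)[of n] FX[of n] by (intro transI) (unfold E_iff, blast elim: equivE dest: transD)
  qed
  have EH: "E n \<subseteq> H" for n
  proof -
    have "F n \<subseteq> H" using HF by blast
    moreover have "(x, x) \<in> H" if "x \<in> space M" for x using HN(2) that by (meson equivE refl_onD)
    ultimately show ?thesis by (auto simp: E_def)
  qed
  have HR: "H \<subseteq> R" using HN(1) sets_N by blast
  have EN: "E n \<in> sets N" for n
    using F(2)[of n] diagonal_sets X0(1) EH HR by (auto simp: sets_N E_def)
  have "finite (E n `` {x})" for n x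
  proof (rule finite_subset)
    show "E n `` {x} \<subseteq> insert x (if x \<in> X0 then F n `` {x} else {})"
      using FX[of n] by (auto simp: E_iff)
    show "finite (insert x (if x \<in> X0 then F n `` {x} else {}))" using F(4) by simp
  qed
  moreover have "\<exists>n. measure m (H - E n) < e"
  proof -
    have "decseq (\<lambda>n. H - E n)"
      using F(1) unfolding decseq_def incseq_def E_def by blast
    then have lim: "(\<lambda>n. measure m (H - E n)) \<longlonglongrightarrow> measure m (\<Inter>n. H - E n)"
      using HN EN sm by (intro m.finite_Lim_measure_decseq) auto
    \<comment> \<open>Inside the conull set \<open>X0\<close> the \<open>F n\<close> exhaust
      \<open>H\<close>, so no pair over \<open>X0\<close> remains.\<close>
    have "(\<Inter>n. H - E n) \<in> null_sets N"
    proof (rule null_sets_N_off_conull[OF _ X0])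
      show "(\<Inter>n. H - E n) \<in> sets N" using HN EN by auto
      fix x y assume "(x, y) \<in> (\<Inter>n. H - E n)" "x \<in> X0" "y \<in> X0"
      then show False using HF by (auto simp: E_def)
    qed
    then have "measure m (\<Inter>n. H - E n) = 0"
      using m(2) by (auto simp: equivalent_measures_def absolutely_continuous_def
        intro!: measure_eq_0_null_sets)
    then have "\<forall>\<^sub>F n in sequentially. measure m (H - E n) < e"
      using lim e order_tendstoD(2) by metis
    then show ?thesis by (auto simp: eventually_sequentially)
  qed
  moreover have "E n \<in> borel_subrels M R" for n using EN E_eq by (simp add: borel_subrels_iff)
  ultimately show ?thesis using EH by meson
qed

lemma locally_finite_exhaustion:
  assumes m: "finite_measure m" "equivalent_measures m N" and e: "(e :: real) > 0"
  shows "\<exists>K\<in>sets N. sym K \<and> (\<forall>x. finite (K `` {x})) \<and> measure m (R - K) < e"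
proof -
  interpret m: finite_measure m by (rule m(1))
  have sm: "sets m = sets N" using m(2) by (simp add: equivalent_measures_def)
  define \<Gamma> where "\<Gamma> i = {(x, g i x) | x. x \<in> space M}" for i
  have \<Gamma>: "\<Gamma> i \<in> sets N" for i
    using graph_measurable(2)[OF std g_measurable g_measurable] g_in_R by (auto simp: sets_N \<Gamma>_def)
  \<comment> \<open>Adding the converses makes \<open>K n\<close> symmetric. Sections remain finite
    because each \<open>g i\<close> is injective.\<close>
  define K where "K n = (\<Union>i<n. \<Gamma> i \<union> (\<Gamma> i)\<inverse>)" for n :: nat
  have K: "K n \<in> sets N" for n using \<Gamma> sets_N_converse[OF \<Gamma>] by (auto simp: K_def)
  have "sym (K n)" for n by (auto simp: K_def sym_def)
  moreover have "finite (K n `` {x})" for n x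
  proof -
    have "finite ((\<Gamma> i)\<inverse> `` {x})" for i
    proof (cases "(\<Gamma> i)\<inverse> `` {x} = {}")
      case False
      then obtain z where z: "(z, x) \<in> \<Gamma> i" by blast
      have "y = z" if "(y, x) \<in> \<Gamma> i" for y
      proof (rule g_inj)
        show "y \<in> space M" "z \<in> space M" "g i y = g i z" using that z by (auto simp: \<Gamma>_def)
      qed
      then have "(\<Gamma> i)\<inverse> `` {x} \<subseteq> {z}" by blast
      then show ?thesis using finite_subset by blast
    qed simp
    moreover have "finite (\<Gamma> i `` {x})" for i
      by (rule finite_subset[of _ "{g i x}"]) (auto simp: \<Gamma>_def)
    moreover have "K n `` {x} = (\<Union>i<n. \<Gamma> i `` {x} \<union> (\<Gamma> i)\<inverse> `` {x})" by (auto simp: K_def)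
    ultimately show ?thesis by simp
  qed
  moreover have "\<exists>n. measure m (R - K n) < e"
  proof -
    have RN: "R \<in> sets N" by (simp add: sets_N R_sets)
    have "decseq (\<lambda>n. R - K n)"
      by (auto simp: decseq_def K_def)
    then have lim: "(\<lambda>n. measure m (R - K n)) \<longlonglongrightarrow> measure m (\<Inter>n. R - K n)"
      using RN K sm by (intro m.finite_Lim_measure_decseq) auto
    have "p \<in> (\<Union>n. K n)" if p: "p \<in> R" for p
    proof -
      obtain x i where "p = (x, g i x)" "x \<in> space M" using p R_eq by blast
      then have "p \<in> K (Suc i)" by (auto simp: K_def \<Gamma>_def)
      then show ?thesis by blast
    qed
    then have "(\<Inter>n. R - K n) = {}" by blast
    then have "\<forall>\<^sub>F n in sequentially. measure m (R - K n) < e"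
      using lim e order_tendstoD(2) by (metis measure_empty)
    then show ?thesis by (auto simp: eventually_sequentially)
  qed
  ultimately show ?thesis using K by blast
qed

end

section \<open>The limit matching as an element of the full group\<close>

context matching
begin

lemma limit_conull:
  assumes "ergodic_rel M R" "aperiodic_rel M S" "everywhere_infinite_index M R S"
  shows "space M - Domain limit \<in> null_sets M" "space M - Range limit \<in> null_sets M"
proof -
  note sets [measurable] = sets_Domain[OF limit_sets] sets_Range[OF limit_sets]
  have eq: "prob (Domain limit) = prob (Range limit)"
    using emeasure_Domain_eq_Range[OF limit_sets limit_single_valued] by (simp add: measure_def)
  let ?Y = "space M - Range limit"
  have Y: "?Y \<in> sets M" by measurable
  have "prob (Domain limit) = 1"
  proof (cases "emeasure M ?Y > 0")
    case True
    have "AE x in M. x \<in> Domain limit"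
      using many_infinite_classes[OF assms(1) S_sets S_equiv assms(2,3) Y True] AE_space
    proof eventually_elim
      case (elim x)
      then show ?case using limit_maximal by blast
    qed
    then show ?thesis using prob_eq_1[OF sets(1)] by simp
  next
    case False
    then have "prob ?Y = 0" by (simp add: measure_def)
    then show ?thesis using prob_compl[OF sets(2)] eq by simp
  qed
  then show "space M - Domain limit \<in> null_sets M" "space M - Range limit \<in> null_sets M"
    using prob_compl[OF sets(1)] prob_compl[OF sets(2)] eq
    by (auto simp: null_sets_def emeasure_eq_measure)
qed

lemma full_group_approx:
  assumes "ergodic_rel M R" "aperiodic_rel M S" "everywhere_infinite_index M R S"
  shows "\<exists>T\<in>full_group M R. \<exists>Z\<in>sets M. space M - Z \<in> null_sets M \<and>
    (\<forall>x\<in>Z. \<forall>y\<in>Z. (x, y) \<in> K \<longrightarrow> (x, y) \<in> map_prod T T ` S \<longleftrightarrow> (x, y) \<in> F)"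
proof -
  note lim [measurable] = sets_Domain[OF limit_sets] sets_Range[OF limit_sets]
  have "(space M - Domain limit) \<union> (space M - Range limit) \<in> null_sets M"
    using limit_conull[OF assms] by blast
  then have "space M - (Domain limit \<inter> Range limit) \<in> null_sets M"
    by (simp add: Diff_Int)
  moreover have "Domain limit \<inter> Range limit \<in> sets M" by measurable
  ultimately obtain B where B: "B \<in> sets M" "B \<subseteq> Domain limit \<inter> Range limit"
    "space M - B \<in> null_sets M" "\<And>x y. (x, y) \<in> R \<Longrightarrow> x \<in> B \<Longrightarrow> y \<in> B"
    using conull_invariant_subset by blast
  have B': "B \<subseteq> space M" using sets.sets_into_space[OF B(1)] .
  have LR: "limit \<subseteq> R" using limit_sets sets_N by blast
  \<comment> \<open>The matching is kept on the invariant conull set \<open>B\<close> and replaced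
    by the identity elsewhere; invariance makes the two parts fit together to a bijection.\<close>
  define Q where "Q = limit \<inter> (B \<times> B) \<union> Id_on (space M) \<inter> ((space M - B) \<times> space M)"
  have Q_iff: "(x, y) \<in> Q \<longleftrightarrow> (x, y) \<in> limit \<and> x \<in> B \<and> y \<in> B \<or> x = y \<and> x \<in> space M - B" for x y
    by (auto simp: Q_def)
  have LB: "x \<in> B \<longleftrightarrow> y \<in> B" if "(x, y) \<in> limit" for x y
    using that LR B(4) R_sym by blast
  have "Q \<in> sets N"
    using limit_sets diagonal_sets B(1) R_refl unfolding sets_N Q_def by auto
  then have QN: "Q\<inverse> \<in> sets N" by (rule sets_N_converse)
  have sv: "single_valued Q" "single_valued (Q\<inverse>)"
    using limit_single_valued unfolding single_valued_def converse_iff Q_iff by blast+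
  have dom: "Domain Q = space M" "Range Q = space M"
    using B(2) B' LB unfolding set_eq_iff Domain_iff Range_iff Q_iff by blast+
  obtain T where T: "T \<in> full_group M R" "Q\<inverse> = {(x, T x) | x. x \<in> space M}"
    using full_group_of_graph[OF QN sv(2)] sv(1) dom by auto
  have QT: "(x, y) \<in> Q \<longleftrightarrow> y \<in> space M \<and> x = T y" for x y
    using T(2) by (auto simp flip: converse_iff[of x y Q])
  \<comment> \<open>\<open>T\<close> is inverse to the matching, so a pair lies in the image of
    \<open>S\<close> exactly when its matched pair lies in \<open>S\<close>.\<close>
  have TS: "(x, y) \<in> map_prod T T ` S \<longleftrightarrow> (\<exists>x' y'. (x, x') \<in> Q \<and> (y, y') \<in> Q \<and> (x', y') \<in> S)" for x y
    unfolding QT using FS_space(2) by auto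
  have "(x, y) \<in> map_prod T T ` S \<longleftrightarrow> (x, y) \<in> F" if xy: "x \<in> B" "y \<in> B" "(x, y) \<in> K" for x y
  proof
    assume "(x, y) \<in> F"
    obtain x' where x': "(x, x') \<in> limit" using B(2) xy(1) by blast
    then obtain y' where "(y, y') \<in> limit" "(x', y') \<in> S" using limit_F \<open>(x, y) \<in> F\<close> by blast
    then show "(x, y) \<in> map_prod T T ` S" unfolding TS Q_iff using x' xy LB by blast
  next
    assume "(x, y) \<in> map_prod T T ` S"
    then obtain x' y' where "(x, x') \<in> limit" "(y, y') \<in> limit" "(x', y') \<in> S"
      unfolding TS Q_iff using xy by blast
    then show "(x, y) \<in> F" using limit_K xy(3) by blast
  qed
  then show ?thesis using T(1) B(1,3) by blast
qed

end

section \<open>Hyperfinite relations as limits of the orbit\<close>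

lemma (in pmp_relation) hyperfinite_orbit_approx:
  assumes m: "finite_measure m" "equivalent_measures m N"
    and erg: "ergodic_rel M R"
    and S: "S \<in> borel_subrels M R" "aperiodic_rel M S" "everywhere_infinite_index M R S"
    and H: "H \<in> borel_subrels M R" "hyperfinite_rel M H" and e: "(e :: real) > 0"
  shows "\<exists>T\<in>full_group M R. measure m (sym_diff H (map_prod T T ` S \<inter> R)) < e"
proof -
  interpret m: finite_measure m by (rule m(1))
  have sm: "sets m = sets N" using m(2) by (simp add: equivalent_measures_def)
  obtain F where F: "F \<in> borel_subrels M R" "F \<subseteq> H" "\<And>x. finite (F `` {x})" "measure m (H - F) < e / 2"
    using hyperfinite_finite_approx[OF m H, of "e / 2"] e by auto
  obtain K where K: "K \<in> sets N" "sym K" "\<And>x. finite (K `` {x})" "measure m (R - K) < e / 2"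
    using locally_finite_exhaustion[OF m, of "e / 2"] e by auto
  obtain c :: "nat \<Rightarrow> 'a \<Rightarrow> nat" where c: "\<And>n. c n \<in> M \<rightarrow>\<^sub>M count_space UNIV"
    "\<And>x y. x \<in> space M \<Longrightarrow> y \<in> space M \<Longrightarrow> x \<noteq> y \<Longrightarrow> \<exists>n0. \<forall>n\<ge>n0. c n x \<noteq> c n y"
    using signature_ex by blast
  interpret matching M R g F K S c
    by unfold_locales (use F K S c in \<open>auto simp: borel_subrels_iff\<close>)
  obtain T Z where T: "T \<in> full_group M R" and Z: "Z \<in> sets M" "space M - Z \<in> null_sets M"
    "\<And>x y. x \<in> Z \<Longrightarrow> y \<in> Z \<Longrightarrow> (x, y) \<in> K \<Longrightarrow> (x, y) \<in> map_prod T T ` S \<longleftrightarrow> (x, y) \<in> F"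
    using full_group_approx[OF erg S(2,3)] by blast
  let ?TS = "map_prod T T ` S \<inter> R"
  have sets: "?TS \<in> sets N" "H \<in> sets N" "R \<in> sets N"
    using full_group_image_subrel[OF T S(1)] H(1) R_sets by (auto simp: borel_subrels_iff sets_N)
  let ?D = "sym_diff F ?TS \<inter> K"
  have "?D \<in> null_sets N"
  proof (rule null_sets_N_off_conull[OF _ Z(1,2)])
    show "?D \<in> sets N" using F_sets sets K(1) by auto
    fix x y assume "(x, y) \<in> ?D" "x \<in> Z" "y \<in> Z"
    then show False using Z(3) sub_R by blast
  qed
  then have D: "measure m ?D = 0"
    using m(2) by (auto simp: equivalent_measures_def absolutely_continuous_def
      intro!: measure_eq_0_null_sets)
  \<comment> \<open>On \<open>K\<close> and off \<open>?D\<close>, the relations \<open>F\<close>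
    and \<open>?TS\<close> agree. As \<open>F \<subseteq> H\<close>, they can then differ from
    \<open>H\<close> only on \<open>H - F\<close>.\<close>
  have "measure m (sym_diff H ?TS) \<le> measure m (?D \<union> ((H - F) \<union> (R - K)))"
    using F_sets sets K(1) sm F(2) sub_R by (intro m.finite_measure_mono) auto
  also have "\<dots> \<le> measure m ?D + measure m ((H - F) \<union> (R - K))"
    using F_sets sets K(1) sm by (intro measure_Un_le) auto
  also have "\<dots> \<le> 0 + (measure m (H - F) + measure m (R - K))"
    unfolding D using F_sets sets K(1) sm by (intro add_left_mono measure_Un_le) auto
  also have "\<dots> < e" using F(4) K(4) by simp
  finally show ?thesis using T by blast
qed

theorem theorem4p11:
  fixes M :: "'a measure" and R S :: "('a \<times> 'a) set" and m :: "('a \<times> 'a) measure"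
  assumes "standard_prob_space M"
    and "pmp_equiv_rel M R"
    and "ergodic_rel M R"
    and "S \<in> borel_subrels M R"
    and "aperiodic_rel M S"
    and "everywhere_infinite_index M R S"
    and "finite_measure m"
    and "equivalent_measures m (rel_measure M R)"
  shows "Sub_hyp M R \<subseteq> Sub_topology M R m closure_of full_group_orbit M R S"
proof
  obtain g where "pmp_relation M R g"
    using pmp_relation_ex assms(1,2) unfolding standard_prob_space_def by blast
  then interpret pmp_relation M R g .
  interpret d: Metric_space "malg N" "malg_dist m" by (rule Metric_space_malg[OF assms(7,8)])
  fix P assume "P \<in> Sub_hyp M R"
  then obtain H where H: "H \<in> borel_subrels M R" "hyperfinite_rel M H" "P = malg_class N H"
    unfolding Sub_hyp_def by blast
  have HN: "H \<in> sets N" using H(1) borel_subrels_iff by blast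
  have P: "P \<in> Sub M R" "P \<in> malg N"
    using H(1,3) malg_class_in_malg[OF HN] by (auto simp: Sub_def)
  \<comment> \<open>Closure in a subspace is the trace of the ambient closure of the part of the set
    inside the subspace, and the ambient closure is tested on balls.\<close>
  have "\<exists>Q\<in>Sub M R \<inter> full_group_orbit M R S. Q \<in> d.mball P r" if r: "r > 0" for r
  proof -
    obtain T where T: "T \<in> full_group M R" "measure m (sym_diff H (map_prod T T ` S \<inter> R)) < r"
      using hyperfinite_orbit_approx[OF assms(7,8,3-6) H(1,2) r] by blast
    have TS: "map_prod T T ` S \<inter> R \<in> borel_subrels M R"
      by (rule full_group_image_subrel[OF T(1) assms(4)])
    then have TSN: "map_prod T T ` S \<inter> R \<in> sets N" using borel_subrels_iff by blast
    let ?Q = "malg_class N (map_prod T T ` S \<inter> R)"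
    have "?Q \<in> Sub M R" "?Q \<in> full_group_orbit M R S"
      using TS T(1) by (auto simp: Sub_def full_group_orbit_def)
    moreover have "?Q \<in> d.mball P r"
      using malg_dist_class[OF assms(7,8) HN TSN] T(2) P(2) malg_class_in_malg[OF TSN]
      by (simp add: d.in_mball H(3))
    ultimately show ?thesis by blast
  qed
  then have "P \<in> d.mtopology closure_of (Sub M R \<inter> full_group_orbit M R S)"
    unfolding d.metric_closure_of using P(2) by blast
  then show "P \<in> Sub_topology M R m closure_of full_group_orbit M R S"
    unfolding Sub_topology_def closure_of_subtopology using P(1) by blast
qed

end
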